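(* Consider the Itô stochastic differential equation $d x = f(x)\,dt + h(x)\,d\omega$ on $\mathbb{R}^n$, where $f:\mathbb{R}^n\to\mathbb{R}^n$ and $h:\mathbb{R}^n\to\mathbb{R}^{n\times r}$ are locally Lipschitz continuous and $\omega$ is a standard $r$-dimensional Wiener process. If the equation has a global solution, then it is not stable in probability at any state $x^\ddagger\in\mathbb{R}^n$ with $h(x^\ddagger)\neq 0_{n\times r}$.
   Context: "Has a global solution" means that, from every initial state $x(0)\in\mathbb{R}^n$, the (unique, by local Lipschitz continuity) solution $x(t)$ exists for all $t\ge 0$ almost surely, i.e. there is no explosion. The equation is called stable in probability at a state $\bar x\in\mathbb{R}^n$ (which need not be an equilibrium) if for every $\epsilon>0$ $$\lim_{x(0)\to \bar x}\mathrm{P}\Big(\sup_{t\ge 0}\|x(t)-\bar x\|_2<\epsilon\Big)=1 .$$ *)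

theory Defs
  imports "HOL-Probability.Probability"
begin

text \<open>
  Processes are indexed by \<open>real\<close>, and only times \<open>t \<ge> 0\<close> matter.  The filtration is arbitrary: neither
  completeness nor right-continuity is assumed.
\<close>

locale wiener_process = prob_space M + filtration "space M" F
  for M :: "'w measure" and F :: "real \<Rightarrow> 'w measure" +
  fixes W :: "real \<Rightarrow> 'w \<Rightarrow> real ^ 'r"
  assumes subalg: "\<And>t. 0 \<le> t \<Longrightarrow> subalgebra M (F t)"
    and adapted: "\<And>t. 0 \<le> t \<Longrightarrow> W t \<in> borel_measurable (F t)"
    and continuous_paths: "\<And>\<omega>. \<omega> \<in> space M \<Longrightarrow> continuous_on {0..} (\<lambda>t. W t \<omega>)"
    and initial: "AE \<omega> in M. W 0 \<omega> = 0"
    and increment_indep_past: "\<And>s t. 0 \<le> s \<Longrightarrow> s < t \<Longrightarrow>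
      indep_set (sets (F s)) {(\<lambda>\<omega>. W t \<omega> - W s \<omega>) -` A \<inter> space M | A. A \<in> sets borel}"
    and increment_components_indep: "\<And>s t. 0 \<le> s \<Longrightarrow> s < t \<Longrightarrow>
      indep_vars (\<lambda>_. borel) (\<lambda>i \<omega>. (W t \<omega> - W s \<omega>) $ i) UNIV"
    and increment_gaussian: "\<And>s t i. 0 \<le> s \<Longrightarrow> s < t \<Longrightarrow>
      distributed M lborel (\<lambda>\<omega>. (W t \<omega> - W s \<omega>) $ i) (normal_density 0 (sqrt (t - s)))"

definition continuous_adapted_process ::
  "'w measure \<Rightarrow> (real \<Rightarrow> 'w measure) \<Rightarrow> (real \<Rightarrow> 'w \<Rightarrow> 'a::topological_space) \<Rightarrow> bool" where
  "continuous_adapted_process M F X \<longleftrightarrow>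
     (\<forall>t\<ge>0. X t \<in> borel_measurable (F t)) \<and>
     (\<forall>\<omega>\<in>space M. continuous_on {0..} (\<lambda>t. X t \<omega>))"

text \<open>
  Elementary integrands: \<open>\<Sum>i<k. \<xi> i \<cdot> 1\<^bsub>(\<tau> i, \<tau> (i+1)]\<^esub>\<close> with \<open>\<xi> i\<close> bounded and known at time \<open>\<tau> i\<close>.
\<close>

definition elementary_data ::
  "'w measure \<Rightarrow> (real \<Rightarrow> 'w measure) \<Rightarrow> nat \<Rightarrow> (nat \<Rightarrow> real) \<Rightarrow> (nat \<Rightarrow> 'w \<Rightarrow> real ^ 'r ^ 'n) \<Rightarrow> bool" where
  "elementary_data M F k \<tau> \<xi> \<longleftrightarrow>
     0 \<le> \<tau> 0 \<and> (\<forall>i<k. \<tau> i < \<tau> (Suc i)) \<and>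
     (\<forall>i<k. \<xi> i \<in> borel_measurable (F (\<tau> i)) \<and> bounded (\<xi> i ` space M))"

definition elementary_process ::
  "nat \<Rightarrow> (nat \<Rightarrow> real) \<Rightarrow> (nat \<Rightarrow> 'w \<Rightarrow> real ^ 'r ^ 'n) \<Rightarrow> real \<Rightarrow> 'w \<Rightarrow> real ^ 'r ^ 'n" where
  "elementary_process k \<tau> \<xi> s \<omega> = (\<Sum>i<k. indicator {\<tau> i<..\<tau> (Suc i)} s *\<^sub>R \<xi> i \<omega>)"

definition elementary_integral ::
  "(real \<Rightarrow> 'w \<Rightarrow> real ^ 'r) \<Rightarrow> nat \<Rightarrow> (nat \<Rightarrow> real) \<Rightarrow> (nat \<Rightarrow> 'w \<Rightarrow> real ^ 'r ^ 'n) \<Rightarrow>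
     real \<Rightarrow> 'w \<Rightarrow> real ^ 'n" where
  "elementary_integral W k \<tau> \<xi> t \<omega> =
     (\<Sum>i<k. \<xi> i \<omega> *v (W (min (\<tau> (Suc i)) t) \<omega> - W (min (\<tau> i) t) \<omega>))"

text \<open>
  \<open>I\<close> is a continuous version of the Ito integral \<open>t \<mapsto> \<integral>\<^sub>0\<^sup>t H dW\<close> of the adapted, jointly measurable
  integrand \<open>H\<close>: on every \<open>[0, t]\<close>, elementary integrands converge to \<open>H\<close> in \<open>L\<^sup>2([0, t])\<close> in
  probability and their integrals converge to \<open>I t\<close> in probability.  Path continuity makes \<open>I\<close>
  unique up to indistinguishability.  The norm on matrices is the Frobenius norm.
\<close>

definition has_ito_integral ::
  "'w measure \<Rightarrow> (real \<Rightarrow> 'w measure) \<Rightarrow> (real \<Rightarrow> 'w \<Rightarrow> real ^ 'r) \<Rightarrow>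
     (real \<Rightarrow> 'w \<Rightarrow> real ^ 'r ^ 'n) \<Rightarrow> (real \<Rightarrow> 'w \<Rightarrow> real ^ 'n) \<Rightarrow> bool" where
  "has_ito_integral M F W H I \<longleftrightarrow>
     (\<forall>t\<ge>0. H t \<in> borel_measurable (F t)) \<and>
     (\<lambda>(t, \<omega>). H t \<omega>) \<in> borel_measurable (restrict_space borel {0..} \<Otimes>\<^sub>M M) \<and>
     (\<forall>t\<ge>0. I t \<in> borel_measurable M) \<and>
     (AE \<omega> in M. continuous_on {0..} (\<lambda>t. I t \<omega>)) \<and>
     (\<exists>k \<tau> \<xi>.
        (\<forall>m. elementary_data M F (k m) (\<tau> m) (\<xi> m)) \<and>
        (\<forall>t\<ge>0. \<forall>\<epsilon>>0.
           (\<lambda>m. measure M {\<omega> \<in> space M.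
              (\<integral>\<^sup>+ s\<in>{0..t}. ennreal ((norm (elementary_process (k m) (\<tau> m) (\<xi> m) s \<omega> - H s \<omega>))\<^sup>2) \<partial>lborel)
                > ennreal \<epsilon>}) \<longlonglongrightarrow> 0) \<and>
        (\<forall>t\<ge>0. \<forall>\<epsilon>>0.
           (\<lambda>m. measure M {\<omega> \<in> space M.
              norm (elementary_integral W (k m) (\<tau> m) (\<xi> m) t \<omega> - I t \<omega>) > \<epsilon>}) \<longlonglongrightarrow> 0))"

text \<open>
  \<open>X\<close> solves \<open>dX = f(X) dt + h(X) dW\<close> with \<open>X 0 = x0\<close> on the whole half-line \<open>[0, \<infinity>)\<close>.
\<close>

definition global_sde_solution ::
  "'w measure \<Rightarrow> (real \<Rightarrow> 'w measure) \<Rightarrow> (real \<Rightarrow> 'w \<Rightarrow> real ^ 'r) \<Rightarrow>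
     (real ^ 'n \<Rightarrow> real ^ 'n) \<Rightarrow> (real ^ 'n \<Rightarrow> real ^ 'r ^ 'n) \<Rightarrow>
     real ^ 'n \<Rightarrow> (real \<Rightarrow> 'w \<Rightarrow> real ^ 'n) \<Rightarrow> bool" where
  "global_sde_solution M F W f h x0 X \<longleftrightarrow>
     continuous_adapted_process M F X \<and>
     (\<exists>I. has_ito_integral M F W (\<lambda>t \<omega>. h (X t \<omega>)) I \<and>
        (AE \<omega> in M. \<forall>t\<ge>0. X t \<omega> = x0 + (LBINT s:{0..t}. f (X s \<omega>)) + I t \<omega>))"

definition has_global_solution ::
  "'w measure \<Rightarrow> (real \<Rightarrow> 'w measure) \<Rightarrow> (real \<Rightarrow> 'w \<Rightarrow> real ^ 'r) \<Rightarrow>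
     (real ^ 'n \<Rightarrow> real ^ 'n) \<Rightarrow> (real ^ 'n \<Rightarrow> real ^ 'r ^ 'n) \<Rightarrow> bool" where
  "has_global_solution M F W f h \<longleftrightarrow> (\<forall>x0. \<exists>X. global_sde_solution M F W f h x0 X)"

text \<open>
  For locally Lipschitz coefficients the solution from \<open>x0\<close> is unique up to indistinguishability, so
  the probabilities below do not depend on the family \<open>X\<close> of solutions that is chosen.  The
  supremum is taken in \<open>ereal\<close>, as a path may be unbounded.
\<close>

definition stable_in_probability_at ::
  "'w measure \<Rightarrow> (real \<Rightarrow> 'w measure) \<Rightarrow> (real \<Rightarrow> 'w \<Rightarrow> real ^ 'r) \<Rightarrow>
     (real ^ 'n \<Rightarrow> real ^ 'n) \<Rightarrow> (real ^ 'n \<Rightarrow> real ^ 'r ^ 'n) \<Rightarrow> real ^ 'n \<Rightarrow> bool" where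
  "stable_in_probability_at M F W f h xbar \<longleftrightarrow>
     (\<exists>X. (\<forall>x0. global_sde_solution M F W f h x0 (X x0)) \<and>
        (\<forall>\<epsilon>>0. ((\<lambda>x0. measure M {\<omega> \<in> space M.
             (SUP t\<in>{0..}. ereal (norm (X x0 t \<omega> - xbar))) < ereal \<epsilon>}) \<longlongrightarrow> 1) (at xbar)))"

end

theory Submission
  imports Defs
begin

text \<open>
  A solution that stays near \<open>x\<close> must have its noise cancelled by its drift, and noise of a fixed nonzero
  strength cannot be cancelled.  Suppose that the equation is stable in probability at \<open>x\<close>.  Start
  solutions closer and closer to \<open>x\<close>: with probability tending to \<open>1\<close> they stay in smaller and smaller
  balls around \<open>x\<close> for all time.  At the fixed time \<open>1\<close>, in probability, the left-hand side of
  \<open>X 1 - X 0 = \<integral>\<^sub>0\<^sup>1 f(X) ds + \<integral>\<^sub>0\<^sup>1 h(X) dW\<close> tends to \<open>0\<close>, and by continuity of the coefficients the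
  integrals tend to \<open>f x\<close> and \<open>h x *v (W 1 - W 0)\<close>.  Hence \<open>f x + h x *v (W 1 - W 0) = 0\<close> almost surely.  A
  nonzero row \<open>c\<close> of \<open>h x\<close> would make \<open>c \<bullet> (W 1 - W 0)\<close> almost surely constant, although the covariance of
  the increment is the identity (\<open>increment_combination_not_constant\<close>).

  The limit of the stochastic integrals is the continuity of the Ito integral in probability:
  \<open>P(\<bar>\<integral> H dW\<bar> \<ge> \<epsilon>) \<le> C \<delta> / \<epsilon>\<^sup>2 + P(\<integral> \<bar>H\<bar>\<^sup>2 ds > \<delta>)\<close>.  It is proved for discrete integrals by truncation
  and Chebyshev's inequality (\<open>ito_sum_tail_bound\<close>), transferred to elementary integrands minus a constant
  matrix (\<open>elementary_integral_tail_bound\<close>), and extended to Ito integrals by approximation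
  (\<open>ito_integral_near_constant\<close>).
\<close>

section \<open>Measurability, grids and time integrals\<close>

lemma borel_measurable_component [measurable]:
  fixes g :: "'b \<Rightarrow> 'a :: real_normed_vector ^ 'c"
  assumes "g \<in> borel_measurable N"
  shows "(\<lambda>x. g x $ a) \<in> borel_measurable N"
  by (rule measurable_compose[OF assms])
     (intro borel_measurable_continuous_onI continuous_intros)

lemma borel_measurable_matrix_vector_mult:
  fixes A :: "'b \<Rightarrow> real ^ 'r ^ 'n" and v :: "'b \<Rightarrow> real ^ 'r"
  assumes "A \<in> borel_measurable N" "v \<in> borel_measurable N"
  shows "(\<lambda>y. A y *v v y) \<in> borel_measurable N"
  using assms
proof (rule borel_measurable_continuous_Pair)
  show "continuous_on UNIV (\<lambda>p :: (real ^ 'r ^ 'n) \<times> (real ^ 'r). fst p *v snd p)"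
    unfolding matrix_vector_mult_def
    by (intro continuous_on_vec_lambda continuous_intros)
qed

lemma grid_mono:
  fixes \<sigma> :: "nat \<Rightarrow> real"
  assumes "\<And>i. i < k \<Longrightarrow> \<sigma> i \<le> \<sigma> (Suc i)" "a \<le> b" "b \<le> k"
  shows "\<sigma> a \<le> \<sigma> b"
  using assms(2,3)
proof (induction b)
  case (Suc b)
  then show ?case using assms(1)[of b] by (cases "a = Suc b") auto
qed simp

text \<open>
  The partial sums of \<open>q\<close> increase, so the terms kept are exactly those before the partial sums pass
  the level \<open>\<delta>\<close>.  This is the discrete stopping rule used to truncate integrands below.
\<close>

lemma capped_sum_le:
  fixes q :: "nat \<Rightarrow> real"
  assumes "\<And>i. i < k \<Longrightarrow> 0 \<le> q i" "0 \<le> \<delta>"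
  shows "(\<Sum>i<k. if (\<Sum>j\<le>i. q j) \<le> \<delta> then q i else 0) \<le> \<delta>"
  using assms
proof (induction k)
  case (Suc k)
  show ?case
  proof (cases "(\<Sum>j\<le>k. q j) \<le> \<delta>")
    case True
    have "(\<Sum>i<Suc k. if (\<Sum>j\<le>i. q j) \<le> \<delta> then q i else 0) \<le> (\<Sum>i<Suc k. q i)"
      using Suc.prems by (intro sum_mono) auto
    then show ?thesis using True by (simp add: lessThan_Suc_atMost)
  next
    case False
    then show ?thesis using Suc by simp
  qed
qed simp

lemma time_integral_near_constant:
  fixes g :: "real \<Rightarrow> 'a :: {banach, second_countable_topology}"
  assumes "0 \<le> t" and cont: "continuous_on {0..t} g"
    and near: "\<And>s. 0 \<le> s \<Longrightarrow> s \<le> t \<Longrightarrow> norm (g s - v) \<le> p"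
  shows "norm ((LBINT s:{0..t}. g s) - t *\<^sub>R v) \<le> p * t"
proof -
  have g: "integrable lborel (\<lambda>s. indicator {0..t} s *\<^sub>R g s)"
    using borel_integrable_atLeastAtMost'[OF cont] unfolding set_integrable_def .
  have "t *\<^sub>R v = (LINT s|lborel. indicator {0..t} s *\<^sub>R v)"
    using \<open>0 \<le> t\<close> by simp
  then have "(LBINT s:{0..t}. g s) - t *\<^sub>R v = (LINT s|lborel. indicator {0..t} s *\<^sub>R g s - indicator {0..t} s *\<^sub>R v)"
    unfolding set_lebesgue_integral_def using g \<open>0 \<le> t\<close> by simp
  also have "norm \<dots> \<le> (LINT s|lborel. indicator {0..t} s *\<^sub>R p)"
  proof (rule Bochner_Integration.integral_norm_bound_integral)
    show "norm (indicator {0..t} s *\<^sub>R g s - indicator {0..t} s *\<^sub>R v) \<le> indicator {0..t} s *\<^sub>R p" for s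
      using near[of s] by (auto simp: indicator_def)
  qed (use g \<open>0 \<le> t\<close> in auto)
  also have "\<dots> = p * t" using \<open>0 \<le> t\<close> by simp
  finally show ?thesis .
qed

section \<open>Elementary integrands as step functions of time\<close>

lemma elementary_grid_nonneg:
  assumes "elementary_data M F k \<tau> \<xi>" "j \<le> k"
  shows "0 \<le> \<tau> j"
proof -
  have "0 \<le> \<tau> 0" "\<And>i. i < k \<Longrightarrow> \<tau> i \<le> \<tau> (Suc i)"
    using assms(1) unfolding elementary_data_def by (auto intro: less_imp_le)
  then show ?thesis using grid_mono[of k \<tau> 0 j] assms(2) by fastforce
qed

lemma elementary_process_on_step:
  assumes \<tau>: "\<forall>i<k. \<tau> i < \<tau> (Suc i)" and "i < k" "\<tau> i < s" "s \<le> \<tau> (Suc i)"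
  shows "elementary_process k \<tau> \<xi> s \<omega> = \<xi> i \<omega>"
proof -
  have mono: "\<tau> a \<le> \<tau> b" if "a \<le> b" "b \<le> k" for a b
    using grid_mono[OF _ that, of \<tau>] \<tau> by (auto intro: less_imp_le)
  have "indicator {\<tau> j<..\<tau> (Suc j)} s *\<^sub>R \<xi> j \<omega> = (if j = i then \<xi> i \<omega> else 0)" if "j < k" for j
  proof (cases "j = i")
    case False
    then have "Suc j \<le> i \<or> Suc i \<le> j" by auto
    then show ?thesis using mono[of "Suc j" i] mono[of "Suc i" j] assms that by (auto simp: indicator_def)
  qed (use assms in auto)
  then show ?thesis using \<open>i < k\<close> by (simp add: elementary_process_def)
qed

lemma elementary_process_outside:
  assumes \<tau>: "\<forall>i<k. \<tau> i < \<tau> (Suc i)" and "s \<le> \<tau> 0 \<or> \<tau> k < s"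
  shows "elementary_process k \<tau> \<xi> s \<omega> = 0"
proof -
  have mono: "\<tau> a \<le> \<tau> b" if "a \<le> b" "b \<le> k" for a b
    using grid_mono[OF _ that, of \<tau>] \<tau> by (auto intro: less_imp_le)
  have "s \<notin> {\<tau> j<..\<tau> (Suc j)}" if "j < k" for j
    using assms(2) mono[of 0 j] mono[of "Suc j" k] that by auto
  then show ?thesis unfolding elementary_process_def by (intro sum.neutral) auto
qed

text \<open>
  Comparing with the function of time \<open>g\<close> on each step is what turns the quadratic sums attached to a
  grid into the \<open>L\<^sup>2([0, t])\<close> distances that appear in the definition of the Ito integral.
\<close>

lemma step_sum_le_nn_integral:
  fixes \<sigma> :: "nat \<Rightarrow> real" and u :: "nat \<Rightarrow> real" and g :: "real \<Rightarrow> real"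
  assumes mono: "\<And>i. i < k \<Longrightarrow> \<sigma> i \<le> \<sigma> (Suc i)" and u: "\<And>i. i < k \<Longrightarrow> 0 \<le> u i"
    and g: "\<And>i s. i < k \<Longrightarrow> \<sigma> i < s \<Longrightarrow> s \<le> \<sigma> (Suc i) \<Longrightarrow> u i \<le> g s"
  shows "ennreal (\<Sum>i<k. u i * (\<sigma> (Suc i) - \<sigma> i)) \<le> (\<integral>\<^sup>+ s\<in>{\<sigma> 0..\<sigma> k}. ennreal (g s) \<partial>lborel)"
proof -
  have le: "\<sigma> a \<le> \<sigma> b" if "a \<le> b" "b \<le> k" for a b
    using grid_mono[where \<sigma> = \<sigma> and k = k, OF mono that] .
  have "ennreal (\<Sum>i<k. u i * (\<sigma> (Suc i) - \<sigma> i)) = (\<Sum>i<k. ennreal (u i * (\<sigma> (Suc i) - \<sigma> i)))"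
    using mono u by (intro sum_ennreal[symmetric]) auto
  also have "\<dots> = (\<Sum>i<k. \<integral>\<^sup>+ s. ennreal (u i) * indicator {\<sigma> i<..\<sigma> (Suc i)} s \<partial>lborel)"
  proof (rule sum.cong[OF refl])
    fix i assume "i \<in> {..<k}"
    then show "ennreal (u i * (\<sigma> (Suc i) - \<sigma> i)) =
        (\<integral>\<^sup>+ s. ennreal (u i) * indicator {\<sigma> i<..\<sigma> (Suc i)} s \<partial>lborel)"
      using mono[of i] u[of i] by (subst nn_integral_cmult_indicator) (auto simp: ennreal_mult)
  qed
  also have "\<dots> = (\<integral>\<^sup>+ s. (\<Sum>i<k. ennreal (u i) * indicator {\<sigma> i<..\<sigma> (Suc i)} s) \<partial>lborel)"
    by (rule nn_integral_sum[symmetric]) simp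
  also have "\<dots> \<le> (\<integral>\<^sup>+ s\<in>{\<sigma> 0..\<sigma> k}. ennreal (g s) \<partial>lborel)"
  proof (rule nn_integral_mono)
    fix s
    show "(\<Sum>i<k. ennreal (u i) * indicator {\<sigma> i<..\<sigma> (Suc i)} s) \<le> ennreal (g s) * indicator {\<sigma> 0..\<sigma> k} s"
    proof (cases "\<exists>i<k. s \<in> {\<sigma> i<..\<sigma> (Suc i)}")
      case True
      then obtain i where i: "i < k" "\<sigma> i < s" "s \<le> \<sigma> (Suc i)" by auto
      have "ennreal (u j) * indicator {\<sigma> j<..\<sigma> (Suc j)} s = (if j = i then ennreal (u i) else 0)" if "j < k" for j
      proof (cases "j = i")
        case False
        then have "Suc j \<le> i \<or> Suc i \<le> j" by auto
        then show ?thesis using False le[of "Suc j" i] le[of "Suc i" j] i that by (auto simp: indicator_def)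
      qed (use i in auto)
      then have "(\<Sum>i<k. ennreal (u i) * indicator {\<sigma> i<..\<sigma> (Suc i)} s) = ennreal (u i)"
        using i by simp
      also have "\<dots> \<le> ennreal (g s)" using g[OF i] by (rule ennreal_leI)
      also have "\<dots> = ennreal (g s) * indicator {\<sigma> 0..\<sigma> k} s"
        using le[of 0 i] le[of "Suc i" k] i by simp
      finally show ?thesis .
    next
      case False
      then have "(\<Sum>i<k. ennreal (u i) * indicator {\<sigma> i<..\<sigma> (Suc i)} s) = 0"
        by (intro sum.neutral) (auto simp: indicator_def)
      then show ?thesis by simp
    qed
  qed
  finally show ?thesis .
qed

section \<open>Moments of Wiener increments\<close>

context wiener_process
begin

lemma W_measurable_F: "0 \<le> s \<Longrightarrow> s \<le> t \<Longrightarrow> W s \<in> borel_measurable (F t)"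
  using adapted[of s] sets_F_mono[of s t] space_F
  by (auto simp: measurable_def)

lemma F_measurable_imp: "0 \<le> t \<Longrightarrow> Z \<in> borel_measurable (F t) \<Longrightarrow> Z \<in> borel_measurable M"
  using subalg measurable_from_subalg by blast

lemma F_measurable_mono:
  "s \<le> t \<Longrightarrow> Z \<in> borel_measurable (F s) \<Longrightarrow> Z \<in> borel_measurable (F t)"
  using sets_F_mono[of s t] space_F by (auto simp: measurable_def)

lemma W_measurable: "0 \<le> s \<Longrightarrow> W s \<in> borel_measurable M"
  using W_measurable_F[of s s] F_measurable_imp by blast

lemma increment_moments:
  assumes "0 \<le> s" "s < t"
  shows "integrable M (\<lambda>\<omega>. (W t \<omega> - W s \<omega>) $ i)"
    and "expectation (\<lambda>\<omega>. (W t \<omega> - W s \<omega>) $ i) = 0"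
    and "integrable M (\<lambda>\<omega>. ((W t \<omega> - W s \<omega>) $ i)\<^sup>2)"
    and "expectation (\<lambda>\<omega>. ((W t \<omega> - W s \<omega>) $ i)\<^sup>2) = t - s"
proof -
  let ?d = "normal_density 0 (sqrt (t - s))"
  have pos: "0 < sqrt (t - s)" using assms by simp
  note D = increment_gaussian[OF assms, of i]
  show "integrable M (\<lambda>\<omega>. (W t \<omega> - W s \<omega>) $ i)"
    using distributed_integrable[OF D, of "\<lambda>y. y"] integrable_normal_moment_nz_1[OF pos, of 0] by simp
  show "expectation (\<lambda>\<omega>. (W t \<omega> - W s \<omega>) $ i) = 0"
    using distributed_integral[OF D, of "\<lambda>y. y"] integral_normal_moment_nz_1[OF pos, of 0] by simp
  show "integrable M (\<lambda>\<omega>. ((W t \<omega> - W s \<omega>) $ i)\<^sup>2)"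
    using distributed_integrable[OF D, of "\<lambda>y. y\<^sup>2"] integrable_normal_moment[OF pos, of 0 2] by simp
  show "expectation (\<lambda>\<omega>. ((W t \<omega> - W s \<omega>) $ i)\<^sup>2) = t - s"
    using distributed_integral[OF D, of "\<lambda>y. y\<^sup>2"] integral_normal_moment_even[OF pos, of 0 1] assms
    by (simp add: power2_eq_square)
qed

text \<open>
  Componentwise independence of increments enters the proof through this fact alone: it makes the
  covariance matrix of an increment a multiple of the identity, hence nondegenerate.
\<close>

lemma increment_uncorrelated:
  assumes "0 \<le> s" "s < t" "i \<noteq> j"
  shows "integrable M (\<lambda>\<omega>. (W t \<omega> - W s \<omega>) $ i * (W t \<omega> - W s \<omega>) $ j)"
    and "expectation (\<lambda>\<omega>. (W t \<omega> - W s \<omega>) $ i * (W t \<omega> - W s \<omega>) $ j) = 0"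
proof -
  let ?X = "\<lambda>i \<omega>. (W t \<omega> - W s \<omega>) $ i"
  have *: "indep_vars (\<lambda>_. borel) ?X {i, j}"
    using increment_components_indep[OF assms(1,2)] by (rule indep_vars_subset) auto
  have i: "\<And>k. k \<in> {i,j} \<Longrightarrow> integrable M (?X k)"
    using increment_moments(1)[OF assms(1,2)] by blast
  show "integrable M (\<lambda>\<omega>. ?X i \<omega> * ?X j \<omega>)"
    using indep_vars_integrable[OF _ * i] assms(3) by simp
  show "expectation (\<lambda>\<omega>. ?X i \<omega> * ?X j \<omega>) = 0"
    using indep_vars_lebesgue_integral[OF _ * i] assms(3) increment_moments(2)[OF assms(1,2)] by simp
qed

lemma increment_norm_moment:
  assumes "0 \<le> s" "s < t"
  shows "integrable M (\<lambda>\<omega>. (norm (W t \<omega> - W s \<omega>))\<^sup>2)"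
    and "expectation (\<lambda>\<omega>. (norm (W t \<omega> - W s \<omega>))\<^sup>2) = real CARD('r) * (t - s)"
proof -
  have eq: "(norm v)\<^sup>2 = (\<Sum>i\<in>UNIV. (v $ i)\<^sup>2)" for v :: "real ^ 'r"
    unfolding power2_norm_eq_inner inner_vec_def by (simp add: power2_eq_square)
  show "integrable M (\<lambda>\<omega>. (norm (W t \<omega> - W s \<omega>))\<^sup>2)"
    unfolding eq using increment_moments(3)[OF assms] by (intro Bochner_Integration.integrable_sum) auto
  show "expectation (\<lambda>\<omega>. (norm (W t \<omega> - W s \<omega>))\<^sup>2) = real CARD('r) * (t - s)"
    unfolding eq using increment_moments(3,4)[OF assms]
    by (subst Bochner_Integration.integral_sum) auto
qed

text \<open>
  A Wiener process comes with independence of its increments from the \<open>\<sigma>\<close>-algebra of the past; the product rules for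
  expectations need it for random variables.
\<close>

lemma past_indep_increment:
  fixes Z :: "'w \<Rightarrow> real" and g :: "real ^ 'r \<Rightarrow> real"
  assumes "0 \<le> s" "s < t" and Z: "Z \<in> borel_measurable (F s)" and g: "g \<in> borel_measurable borel"
  shows "indep_var borel Z borel (\<lambda>\<omega>. g (W t \<omega> - W s \<omega>))"
proof -
  have W[measurable]: "W t \<in> borel_measurable M" "W s \<in> borel_measurable M"
    using assms W_measurable by auto
  have Zm: "Z \<in> borel_measurable M" using F_measurable_imp assms by blast
  have D: "(\<lambda>\<omega>. W t \<omega> - W s \<omega>) \<in> borel_measurable M" by measurable
  have I: "indep_set (sets (F s)) {(\<lambda>\<omega>. W t \<omega> - W s \<omega>) -` A \<inter> space M | A. A \<in> sets borel}"
    (is "indep_set _ ?V") using increment_indep_past assms by blast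
  have "indep_set {Z -` A \<inter> space M | A. A \<in> sets borel}
      {(\<lambda>\<omega>. g (W t \<omega> - W s \<omega>)) -` A \<inter> space M | A. A \<in> sets borel}" (is "indep_set ?A ?B")
  proof -
    have "?A \<subseteq> sets (F s)"
      using measurable_sets[OF Z] space_F by auto
    moreover have "?B \<subseteq> ?V"
    proof safe
      fix A :: "real set" assume "A \<in> sets borel"
      then have "g -` A \<in> sets borel" using measurable_sets_borel[OF g] by simp
      then show "\<exists>A'. (\<lambda>\<omega>. g (W t \<omega> - W s \<omega>)) -` A \<inter> space M =
          (\<lambda>\<omega>. W t \<omega> - W s \<omega>) -` A' \<inter> space M \<and> A' \<in> sets borel"
        by (intro exI[of _ "g -` A"]) auto
    qed
    ultimately show ?thesis using I unfolding indep_set_def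
      by (elim indep_sets_mono_sets) (simp split: bool.split)
  qed
  moreover have "Int_stable {X -` A \<inter> space M | A. A \<in> sets borel}" for X :: "'w \<Rightarrow> real"
  proof (rule Int_stableI, clarify)
    fix A B :: "real set" assume "A \<in> sets borel" "B \<in> sets borel"
    then show "\<exists>C. X -` A \<inter> space M \<inter> (X -` B \<inter> space M) = X -` C \<inter> space M \<and> C \<in> sets borel"
      by (intro exI[of _ "A \<inter> B"]) auto
  qed
  ultimately have "indep_set (sigma_sets (space M) ?A) (sigma_sets (space M) ?B)"
    by (intro indep_set_sigma_sets)
  then show ?thesis
    unfolding indep_var_eq using Zm measurable_compose[OF D g] by simp
qed

lemma integrable_bounded_mult:
  fixes Z Y :: "'w \<Rightarrow> real"
  assumes "integrable M Z" "Y \<in> borel_measurable M" "bounded (Y ` space M)"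
  shows "integrable M (\<lambda>\<omega>. Z \<omega> * Y \<omega>)"
proof -
  obtain B where B: "\<And>\<omega>. \<omega> \<in> space M \<Longrightarrow> \<bar>Y \<omega>\<bar> \<le> B"
    using assms(3) unfolding bounded_iff by auto
  have [measurable]: "Z \<in> borel_measurable M" "Y \<in> borel_measurable M" using assms by auto
  have "integrable M (\<lambda>\<omega>. B * \<bar>Z \<omega>\<bar>)" using assms(1) by auto
  then show ?thesis
  proof (rule Bochner_Integration.integrable_bound)
    show "AE \<omega> in M. norm (Z \<omega> * Y \<omega>) \<le> norm (B * \<bar>Z \<omega>\<bar>)"
    proof (rule AE_I2)
      fix \<omega> assume "\<omega> \<in> space M"
      then have "\<bar>Y \<omega>\<bar> \<le> \<bar>B\<bar>" using B by fastforce
      then show "norm (Z \<omega> * Y \<omega>) \<le> norm (B * \<bar>Z \<omega>\<bar>)"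
        unfolding real_norm_def abs_mult abs_abs
        by (subst mult.commute) (rule mult_right_mono[OF _ abs_ge_zero])
    qed
  qed measurable
qed

text \<open>
  The martingale property of the Wiener process, tested against a variable known at time \<open>s\<close>.
\<close>

lemma past_times_increment:
  fixes Z :: "'w \<Rightarrow> real"
  assumes "0 \<le> s" "s < t" and Z: "Z \<in> borel_measurable (F s)" "integrable M Z"
  shows "integrable M (\<lambda>\<omega>. Z \<omega> * (W t \<omega> - W s \<omega>) $ a)"
    and "expectation (\<lambda>\<omega>. Z \<omega> * (W t \<omega> - W s \<omega>) $ a) = 0"
proof -
  have I: "indep_var borel Z borel (\<lambda>\<omega>. (W t \<omega> - W s \<omega>) $ a)"
    by (rule past_indep_increment[OF assms(1-3)]) simp
  note J = increment_moments(1,2)[OF assms(1,2), of a]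
  show "integrable M (\<lambda>\<omega>. Z \<omega> * (W t \<omega> - W s \<omega>) $ a)"
    by (rule indep_var_integrable[OF I Z(2) J(1)])
  show "expectation (\<lambda>\<omega>. Z \<omega> * (W t \<omega> - W s \<omega>) $ a) = 0"
    using indep_var_lebesgue_integral[OF I Z(2) J(1)] J(2) by simp
qed

section \<open>Tail bound for discrete stochastic integrals\<close>

lemma past_inner_increment_measurable:
  fixes \<eta> :: "'w \<Rightarrow> real ^ 'r"
  assumes "0 \<le> s" "s \<le> t" and "\<eta> \<in> borel_measurable (F s)"
  shows "(\<lambda>\<omega>. \<eta> \<omega> \<bullet> (W t \<omega> - W s \<omega>)) \<in> borel_measurable (F t)"
proof -
  have [measurable]: "\<eta> \<in> borel_measurable (F t)" "W s \<in> borel_measurable (F t)" "W t \<in> borel_measurable (F t)"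
    using assms F_measurable_mono W_measurable_F by auto
  show ?thesis by measurable
qed

text \<open>
  The cross term vanishes because the past, including \<open>S\<close> and \<open>\<eta>\<close>, is orthogonal to the increment.  The
  square of \<open>\<eta> \<bullet> (W t - W s)\<close> is estimated by Cauchy-Schwarz, which costs the factor \<open>CARD('r)\<close> compared
  with the exact isometry but leaves a product of two independent variables.
\<close>

lemma ito_step:
  fixes \<eta> :: "'w \<Rightarrow> real ^ 'r" and S :: "'w \<Rightarrow> real"
  assumes "0 \<le> s" "s < t"
    and S: "S \<in> borel_measurable (F s)" "integrable M (\<lambda>\<omega>. (S \<omega>)\<^sup>2)"
    and \<eta>: "\<eta> \<in> borel_measurable (F s)" "bounded (\<eta> ` space M)"
  shows "integrable M (\<lambda>\<omega>. (S \<omega> + \<eta> \<omega> \<bullet> (W t \<omega> - W s \<omega>))\<^sup>2)"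
    and "expectation (\<lambda>\<omega>. (S \<omega> + \<eta> \<omega> \<bullet> (W t \<omega> - W s \<omega>))\<^sup>2)
      \<le> expectation (\<lambda>\<omega>. (S \<omega>)\<^sup>2) + real CARD('r) * expectation (\<lambda>\<omega>. (norm (\<eta> \<omega>))\<^sup>2 * (t - s))"
proof -
  let ?v = "\<lambda>\<omega>. W t \<omega> - W s \<omega>"
  have [measurable]: "S \<in> borel_measurable M" "\<eta> \<in> borel_measurable M"
    "W t \<in> borel_measurable M" "W s \<in> borel_measurable M"
    using assms F_measurable_imp W_measurable by auto
  have [measurable]: "\<eta> \<in> borel_measurable (F s)" "S \<in> borel_measurable (F s)" using \<eta> S by auto
  obtain B where B: "\<And>\<omega>. \<omega> \<in> space M \<Longrightarrow> norm (\<eta> \<omega>) \<le> B"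
    using \<eta>(2) unfolding bounded_iff by auto
  have S1: "integrable M S"
    by (rule square_integrable_imp_integrable) (use S in auto)
  have bd: "bounded ((\<lambda>\<omega>. \<eta> \<omega> $ a) ` space M)" for a
    unfolding bounded_iff
    by (rule exI[of _ B]) (use B component_le_norm_cart[of _ a] in \<open>auto intro: order_trans\<close>)
  have SE: "integrable M (\<lambda>\<omega>. S \<omega> * \<eta> \<omega> $ a)" for a
    by (rule integrable_bounded_mult[OF S1 _ bd]) measurable
  have "(\<lambda>\<omega>. S \<omega> * \<eta> \<omega> $ a) \<in> borel_measurable (F s)" for a by measurable
  note P = past_times_increment[OF assms(1,2) this SE]
  have cross_eq: "S \<omega> * (\<eta> \<omega> \<bullet> ?v \<omega>) = (\<Sum>a\<in>UNIV. S \<omega> * \<eta> \<omega> $ a * ?v \<omega> $ a)" for \<omega>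
    by (simp add: inner_vec_def sum_distrib_left mult.assoc)
  have cross: "integrable M (\<lambda>\<omega>. S \<omega> * (\<eta> \<omega> \<bullet> ?v \<omega>))" "expectation (\<lambda>\<omega>. S \<omega> * (\<eta> \<omega> \<bullet> ?v \<omega>)) = 0"
    unfolding cross_eq using P
    by (auto intro!: Bochner_Integration.integrable_sum simp: Bochner_Integration.integral_sum)
  have N: "integrable M (\<lambda>\<omega>. (norm (\<eta> \<omega>))\<^sup>2)"
    by (rule integrable_const_bound[of _ "B\<^sup>2"])
       (use B in \<open>auto intro!: AE_I2 power_mono\<close>)
  have I: "indep_var borel (\<lambda>\<omega>. (norm (\<eta> \<omega>))\<^sup>2) borel (\<lambda>\<omega>. (norm (?v \<omega>))\<^sup>2)"
    by (rule past_indep_increment[OF assms(1,2)]) measurable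
  note J = increment_norm_moment[OF assms(1,2)]
  have dom: "integrable M (\<lambda>\<omega>. (norm (\<eta> \<omega>))\<^sup>2 * (norm (?v \<omega>))\<^sup>2)"
    by (rule indep_var_integrable[OF I N J(1)])
  have CS: "(\<eta> \<omega> \<bullet> ?v \<omega>)\<^sup>2 \<le> (norm (\<eta> \<omega>))\<^sup>2 * (norm (?v \<omega>))\<^sup>2" for \<omega>
    using Cauchy_Schwarz_ineq[of "\<eta> \<omega>" "?v \<omega>"] by (simp add: power2_norm_eq_inner)
  have D2: "integrable M (\<lambda>\<omega>. (\<eta> \<omega> \<bullet> ?v \<omega>)\<^sup>2)"
    by (rule Bochner_Integration.integrable_bound[OF dom]) (use CS in auto)
  have sq: "(S \<omega> + \<eta> \<omega> \<bullet> ?v \<omega>)\<^sup>2 = (S \<omega>)\<^sup>2 + 2 * (S \<omega> * (\<eta> \<omega> \<bullet> ?v \<omega>)) + (\<eta> \<omega> \<bullet> ?v \<omega>)\<^sup>2" for \<omega>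
    by (simp add: power2_sum)
  show "integrable M (\<lambda>\<omega>. (S \<omega> + \<eta> \<omega> \<bullet> ?v \<omega>)\<^sup>2)"
    unfolding sq using S(2) cross(1) D2 by auto
  have "expectation (\<lambda>\<omega>. (S \<omega> + \<eta> \<omega> \<bullet> ?v \<omega>)\<^sup>2) = expectation (\<lambda>\<omega>. (S \<omega>)\<^sup>2) + expectation (\<lambda>\<omega>. (\<eta> \<omega> \<bullet> ?v \<omega>)\<^sup>2)"
    unfolding sq using S(2) cross D2 by simp
  also have "expectation (\<lambda>\<omega>. (\<eta> \<omega> \<bullet> ?v \<omega>)\<^sup>2) \<le> expectation (\<lambda>\<omega>. (norm (\<eta> \<omega>))\<^sup>2 * (norm (?v \<omega>))\<^sup>2)"
    by (rule integral_mono[OF D2 dom CS])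
  also have "\<dots> = expectation (\<lambda>\<omega>. (norm (\<eta> \<omega>))\<^sup>2) * (real CARD('r) * (t - s))"
    using indep_var_lebesgue_integral[OF I N J(1)] unfolding J(2) .
  also have "\<dots> = real CARD('r) * (expectation (\<lambda>\<omega>. (norm (\<eta> \<omega>))\<^sup>2) * (t - s))"
    by (rule mult.left_commute)
  also have "expectation (\<lambda>\<omega>. (norm (\<eta> \<omega>))\<^sup>2) * (t - s) = expectation (\<lambda>\<omega>. (norm (\<eta> \<omega>))\<^sup>2 * (t - s))"
    by (rule integral_mult_left_zero[symmetric])
  finally show "expectation (\<lambda>\<omega>. (S \<omega> + \<eta> \<omega> \<bullet> ?v \<omega>)\<^sup>2)
      \<le> expectation (\<lambda>\<omega>. (S \<omega>)\<^sup>2) + real CARD('r) * expectation (\<lambda>\<omega>. (norm (\<eta> \<omega>))\<^sup>2 * (t - s))"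
    by simp
qed

text \<open>
  Grid points may coincide, since the grids to which this is applied arise by capping others at a
  time \<open>t\<close>.
\<close>

lemma ito_sum_second_moment:
  fixes \<sigma> :: "nat \<Rightarrow> real" and \<eta> :: "nat \<Rightarrow> 'w \<Rightarrow> real ^ 'r"
  assumes "0 \<le> \<sigma> 0" "\<And>i. i < k \<Longrightarrow> \<sigma> i \<le> \<sigma> (Suc i)"
    and "\<And>i. i < k \<Longrightarrow> \<eta> i \<in> borel_measurable (F (\<sigma> i))"
    and "\<And>i. i < k \<Longrightarrow> bounded (\<eta> i ` space M)"
  defines "S \<equiv> \<lambda>k \<omega>. \<Sum>i<k. \<eta> i \<omega> \<bullet> (W (\<sigma> (Suc i)) \<omega> - W (\<sigma> i) \<omega>)"
  shows "S k \<in> borel_measurable (F (\<sigma> k)) \<and> integrable M (\<lambda>\<omega>. (S k \<omega>)\<^sup>2) \<and>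
    expectation (\<lambda>\<omega>. (S k \<omega>)\<^sup>2) \<le>
      real CARD('r) * expectation (\<lambda>\<omega>. \<Sum>i<k. (norm (\<eta> i \<omega>))\<^sup>2 * (\<sigma> (Suc i) - \<sigma> i))"
  using assms(1-4)
proof (induction k)
  case 0
  then show ?case by (simp add: S_def)
next
  case (Suc k)
  then have IH: "S k \<in> borel_measurable (F (\<sigma> k))" "integrable M (\<lambda>\<omega>. (S k \<omega>)\<^sup>2)"
    "expectation (\<lambda>\<omega>. (S k \<omega>)\<^sup>2) \<le>
      real CARD('r) * expectation (\<lambda>\<omega>. \<Sum>i<k. (norm (\<eta> i \<omega>))\<^sup>2 * (\<sigma> (Suc i) - \<sigma> i))"
    by simp_all
  have nn: "0 \<le> \<sigma> i" if "i \<le> Suc k" for i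
    using grid_mono[of "Suc k" \<sigma> 0 i] Suc.prems(1,2) that by fastforce
  have S_Suc: "S (Suc k) = (\<lambda>\<omega>. S k \<omega> + \<eta> k \<omega> \<bullet> (W (\<sigma> (Suc k)) \<omega> - W (\<sigma> k) \<omega>))"
    by (simp add: S_def fun_eq_iff)
  have \<eta>k: "\<eta> k \<in> borel_measurable (F (\<sigma> k))" "bounded (\<eta> k ` space M)" and le: "\<sigma> k \<le> \<sigma> (Suc k)"
    using Suc.prems by auto
  have meas: "S (Suc k) \<in> borel_measurable (F (\<sigma> (Suc k)))"
    unfolding S_Suc
    by (intro borel_measurable_add F_measurable_mono[OF le IH(1)]
        past_inner_increment_measurable nn le \<eta>k) simp
  have int: "integrable M (\<lambda>\<omega>. (norm (\<eta> i \<omega>))\<^sup>2 * (\<sigma> (Suc i) - \<sigma> i))" if i: "i < Suc k" for i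
  proof -
    have [measurable]: "\<eta> i \<in> borel_measurable M"
      using Suc.prems(3)[OF i] F_measurable_imp nn[of i] i by simp
    obtain B where "\<And>\<omega>. \<omega> \<in> space M \<Longrightarrow> norm (\<eta> i \<omega>) \<le> B"
      using Suc.prems(4)[OF i] unfolding bounded_iff by auto
    then have "integrable M (\<lambda>\<omega>. (norm (\<eta> i \<omega>))\<^sup>2)"
      by (intro integrable_const_bound[of _ "B\<^sup>2"]) (auto intro!: AE_I2 power_mono)
    then show ?thesis by simp
  qed
  show ?case
  proof (cases "\<sigma> k = \<sigma> (Suc k)")
    case True
    then have "S (Suc k) = S k" unfolding S_Suc by simp
    then show ?thesis using IH meas True by simp
  next
    case False
    with le have lt: "\<sigma> k < \<sigma> (Suc k)" by simp
    note step = ito_step[OF nn[of k] lt IH(1,2) \<eta>k]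
    have split: "expectation (\<lambda>\<omega>. \<Sum>i<Suc k. (norm (\<eta> i \<omega>))\<^sup>2 * (\<sigma> (Suc i) - \<sigma> i)) =
      expectation (\<lambda>\<omega>. \<Sum>i<k. (norm (\<eta> i \<omega>))\<^sup>2 * (\<sigma> (Suc i) - \<sigma> i)) +
      expectation (\<lambda>\<omega>. (norm (\<eta> k \<omega>))\<^sup>2 * (\<sigma> (Suc k) - \<sigma> k))"
      unfolding sum.lessThan_Suc
      by (rule Bochner_Integration.integral_add; (intro Bochner_Integration.integrable_sum)?; rule int; simp)
    have "expectation (\<lambda>\<omega>. (S (Suc k) \<omega>)\<^sup>2) \<le> 
      real CARD('r) * expectation (\<lambda>\<omega>. \<Sum>i<Suc k. (norm (\<eta> i \<omega>))\<^sup>2 * (\<sigma> (Suc i) - \<sigma> i))"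
      unfolding split S_Suc using step(2) IH(3) by (simp add: distrib_left)
    then show ?thesis using meas step(1) by (simp only: S_Suc simp_thms)
  qed
qed

text \<open>
  No second moment of the integrand is controlled, only the probability that its quadratic sum \<open>Q\<close>
  is large.  So the integrand is switched off once the quadratic sum accumulated so far exceeds \<open>\<delta>\<close>.
  This decision uses the past alone, so the truncated integrand is again adapted; its quadratic sum is
  at most \<open>\<delta>\<close>, so Chebyshev's inequality applies; and it differs from the original one only where
  \<open>Q > \<delta>\<close>.
\<close>

lemma ito_sum_tail_bound:
  fixes \<sigma> :: "nat \<Rightarrow> real" and \<eta> :: "nat \<Rightarrow> 'w \<Rightarrow> real ^ 'r"
  assumes \<sigma>: "0 \<le> \<sigma> 0" "\<And>i. i < k \<Longrightarrow> \<sigma> i \<le> \<sigma> (Suc i)"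
    and meas: "\<And>i. i < k \<Longrightarrow> \<eta> i \<in> borel_measurable (F (\<sigma> i))"
    and bdd: "\<And>i. i < k \<Longrightarrow> bounded (\<eta> i ` space M)"
    and "0 < \<epsilon>" "0 \<le> \<delta>"
  defines "S \<equiv> \<lambda>\<omega>. \<Sum>i<k. \<eta> i \<omega> \<bullet> (W (\<sigma> (Suc i)) \<omega> - W (\<sigma> i) \<omega>)"
    and "Q \<equiv> \<lambda>\<omega>. \<Sum>i<k. (norm (\<eta> i \<omega>))\<^sup>2 * (\<sigma> (Suc i) - \<sigma> i)"
  shows "S \<in> borel_measurable M" "Q \<in> borel_measurable M"
    "prob {\<omega> \<in> space M. \<bar>S \<omega>\<bar> \<ge> \<epsilon>} \<le> real CARD('r) * \<delta> / \<epsilon>\<^sup>2 + prob {\<omega> \<in> space M. Q \<omega> > \<delta>}"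
proof -
  have nn: "0 \<le> \<sigma> i" if "i \<le> k" for i
    using grid_mono[of k \<sigma> 0 i] \<sigma> that by fastforce
  have mono: "\<sigma> j \<le> \<sigma> i" if "j \<le> i" "i \<le> k" for i j
    using grid_mono[where \<sigma> = \<sigma> and k = k, OF \<sigma>(2) that] .
  define q where "q \<omega> i = (norm (\<eta> i \<omega>))\<^sup>2 * (\<sigma> (Suc i) - \<sigma> i)" for \<omega> i
  have q_nn: "0 \<le> q \<omega> i" if "i < k" for \<omega> i using \<sigma>(2)[OF that] by (simp add: q_def)
  define \<eta>' where "\<eta>' i \<omega> = (if (\<Sum>j\<le>i. q \<omega> j) \<le> \<delta> then \<eta> i \<omega> else 0)" for i \<omega>
  define S' where "S' \<omega> = (\<Sum>i<k. \<eta>' i \<omega> \<bullet> (W (\<sigma> (Suc i)) \<omega> - W (\<sigma> i) \<omega>))" for \<omega>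
  have M': "\<eta>' i \<in> borel_measurable (F (\<sigma> i))" if "i < k" for i
  proof -
    have [measurable]: "\<eta> j \<in> borel_measurable (F (\<sigma> i))" if "j \<in> {..i}" for j
      using meas[of j] mono[of j i] F_measurable_mono that \<open>i < k\<close> by (meson atMost_iff le_less_trans less_imp_le)
    have [measurable]: "\<eta> i \<in> borel_measurable (F (\<sigma> i))" using meas that by blast
    show ?thesis unfolding \<eta>'_def q_def by measurable
  qed
  have B': "bounded (\<eta>' i ` space M)" if "i < k" for i
    by (rule bounded_subset[of "insert 0 (\<eta> i ` space M)"])
       (use bdd[OF that] in \<open>auto simp: \<eta>'_def\<close>)
  have WM: "W (\<sigma> i) \<in> borel_measurable M" if "i \<le> k" for i
    using W_measurable nn that by blast
  have [measurable]: "\<eta> i \<in> borel_measurable M" "\<eta>' i \<in> borel_measurable M"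
     "W (\<sigma> i) \<in> borel_measurable M" "W (\<sigma> (Suc i)) \<in> borel_measurable M" if "i \<in> {..<k}" for i
    using that meas[of i] M'[of i] F_measurable_imp[OF nn[of i]] WM[of i] WM[of "Suc i"] by auto
  show Sm[measurable]: "S \<in> borel_measurable M" unfolding S_def by measurable
  show Qm[measurable]: "Q \<in> borel_measurable M" unfolding Q_def by measurable
  have [measurable]: "S' \<in> borel_measurable M" unfolding S'_def by measurable
  have "(norm (\<eta>' i \<omega>))\<^sup>2 * (\<sigma> (Suc i) - \<sigma> i) = (if (\<Sum>j\<le>i. q \<omega> j) \<le> \<delta> then q \<omega> i else 0)" for i \<omega>
    by (simp add: \<eta>'_def q_def)
  then have cap: "(\<Sum>i<k. (norm (\<eta>' i \<omega>))\<^sup>2 * (\<sigma> (Suc i) - \<sigma> i)) \<le> \<delta>" for \<omega>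
    using capped_sum_le[of k "q \<omega>" \<delta>] q_nn \<open>0 \<le> \<delta>\<close> by simp
  have E: "integrable M (\<lambda>\<omega>. (S' \<omega>)\<^sup>2)"
    "expectation (\<lambda>\<omega>. (S' \<omega>)\<^sup>2) \<le> real CARD('r) * expectation (\<lambda>\<omega>. \<Sum>i<k. (norm (\<eta>' i \<omega>))\<^sup>2 * (\<sigma> (Suc i) - \<sigma> i))"
    using ito_sum_second_moment[OF \<sigma> M' B', of k] unfolding S'_def by auto
  have "expectation (\<lambda>\<omega>. \<Sum>i<k. (norm (\<eta>' i \<omega>))\<^sup>2 * (\<sigma> (Suc i) - \<sigma> i)) \<le> expectation (\<lambda>_. \<delta>)"
  proof (rule integral_mono')
    show "integrable M (\<lambda>_. \<delta>)" by simp
  qed (use cap \<open>0 \<le> \<delta>\<close> in auto)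
  then have "real CARD('r) * expectation (\<lambda>\<omega>. \<Sum>i<k. (norm (\<eta>' i \<omega>))\<^sup>2 * (\<sigma> (Suc i) - \<sigma> i)) \<le> real CARD('r) * \<delta>"
    by (intro mult_left_mono) (simp_all add: prob_space)
  with E(2) have "expectation (\<lambda>\<omega>. (S' \<omega>)\<^sup>2) \<le> real CARD('r) * \<delta>"
    by (rule order_trans)
  then have "expectation (\<lambda>\<omega>. (S' \<omega>)\<^sup>2) / \<epsilon>\<^sup>2 \<le> real CARD('r) * \<delta> / \<epsilon>\<^sup>2"
    by (rule divide_right_mono) simp
  with second_moment_method[OF _ E(1) \<open>0 < \<epsilon>\<close>]
  have cheb: "prob {\<omega> \<in> space M. \<bar>S' \<omega>\<bar> \<ge> \<epsilon>} \<le> real CARD('r) * \<delta> / \<epsilon>\<^sup>2"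
    by (rule order_trans) measurable
  have same: "S' \<omega> = S \<omega>" if "\<not> Q \<omega> > \<delta>" for \<omega>
  proof -
    have "(\<Sum>j\<le>i. q \<omega> j) \<le> \<delta>" if "i < k" for i
    proof -
      have "(\<Sum>j\<le>i. q \<omega> j) \<le> (\<Sum>j<k. q \<omega> j)"
        by (rule sum_mono2) (use that q_nn in auto)
      then show ?thesis using \<open>\<not> Q \<omega> > \<delta>\<close> unfolding Q_def q_def by simp
    qed
    then show ?thesis unfolding S'_def S_def \<eta>'_def by simp
  qed
  have "prob {\<omega> \<in> space M. \<bar>S \<omega>\<bar> \<ge> \<epsilon>} \<le> prob ({\<omega> \<in> space M. \<bar>S' \<omega>\<bar> \<ge> \<epsilon>} \<union> {\<omega> \<in> space M. Q \<omega> > \<delta>})"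
    by (rule finite_measure_mono) (use same in auto)
  also have "\<dots> \<le> prob {\<omega> \<in> space M. \<bar>S' \<omega>\<bar> \<ge> \<epsilon>} + prob {\<omega> \<in> space M. Q \<omega> > \<delta>}"
    by (rule measure_Un_le) measurable
  finally show "prob {\<omega> \<in> space M. \<bar>S \<omega>\<bar> \<ge> \<epsilon>} \<le> real CARD('r) * \<delta> / \<epsilon>\<^sup>2 + prob {\<omega> \<in> space M. Q \<omega> > \<delta>}"
    using cheb by simp
qed

section \<open>Ito integrals of nearly constant integrands\<close>

text \<open>
  An elementary integral minus the integral \<open>C *v (W t - W 0)\<close> of a constant is again a discrete
  stochastic integral, but over the grid of the integrand capped at \<open>t\<close> and completed by \<open>0\<close> and \<open>t\<close>: the
  constant also acts on the times that the original grid does not cover.  Closeness is only required off an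
  event \<open>B\<close>, whose probability is added to the bound.
\<close>

lemma elementary_integral_tail_bound:
  fixes C :: "real ^ 'r ^ 'n" and i :: 'n
  assumes data: "elementary_data M F k \<tau> \<xi>" and "0 < t" "0 < \<epsilon>" "0 \<le> \<delta>"
    and B: "B \<in> events"
    and close: "\<And>\<omega>. \<omega> \<in> space M \<Longrightarrow> \<omega> \<notin> B \<Longrightarrow>
      (\<integral>\<^sup>+ s\<in>{0..t}. ennreal ((norm (elementary_process k \<tau> \<xi> s \<omega> - C))\<^sup>2) \<partial>lborel) \<le> ennreal \<delta>"
  defines "D \<equiv> \<lambda>\<omega>. elementary_integral W k \<tau> \<xi> t \<omega> $ i - C $ i \<bullet> (W t \<omega> - W 0 \<omega>)"
  shows "D \<in> borel_measurable M"
    and "prob {\<omega> \<in> space M. \<bar>D \<omega>\<bar> \<ge> \<epsilon>} \<le> real CARD('r) * \<delta> / \<epsilon>\<^sup>2 + prob B"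
proof -
  have \<tau>0: "0 \<le> \<tau> 0" and \<tau>: "\<forall>i<k. \<tau> i < \<tau> (Suc i)"
    and \<xi>: "\<And>i. i < k \<Longrightarrow> \<xi> i \<in> borel_measurable (F (\<tau> i))"
    and \<xi>b: "\<And>i. i < k \<Longrightarrow> bounded (\<xi> i ` space M)"
    using data unfolding elementary_data_def by auto
  (* The grid 0, min (tau 0) t, ..., min (tau k) t, t has k + 2 steps.  Row i of the elementary
     integrand sits on the steps 1, ..., k and is dropped where its step has been capped to nothing,
     since there it need not be known at time t. *)
  define \<sigma> where "\<sigma> j = (if j = 0 then 0 else if j \<le> Suc k then min (\<tau> (j - 1)) t else t)" for j
  define p where "p j \<omega> = (if 0 < j \<and> j \<le> k \<and> \<tau> (j - 1) < t then \<xi> (j - 1) \<omega> $ i else 0)" for j \<omega>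
  define \<eta> where "\<eta> j \<omega> = p j \<omega> - C $ i" for j \<omega>
  have nn: "0 \<le> \<tau> j" if "j \<le> k" for j
    using elementary_grid_nonneg[OF data that] .
  have \<sigma>_step: "\<sigma> j \<le> \<sigma> (Suc j)" if "j < Suc (Suc k)" for j
  proof (cases j)
    case 0
    then show ?thesis using \<tau>0 \<open>0 < t\<close> by (simp add: \<sigma>_def)
  next
    case (Suc m)
    then show ?thesis using that \<tau>[rule_format, of m] by (auto simp: \<sigma>_def min_def)
  qed
  have \<sigma>0: "0 \<le> \<sigma> 0" by (simp add: \<sigma>_def)
  have \<eta>_meas: "\<eta> j \<in> borel_measurable (F (\<sigma> j))" if "j < Suc (Suc k)" for j
  proof (cases "0 < j \<and> j \<le> k \<and> \<tau> (j - 1) < t")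
    case True
    then have "\<sigma> j = \<tau> (j - 1)" "j - 1 < k" by (auto simp: \<sigma>_def)
    then have [measurable]: "\<xi> (j - 1) \<in> borel_measurable (F (\<sigma> j))" using \<xi> by metis
    have "\<eta> j = (\<lambda>\<omega>. \<xi> (j - 1) \<omega> $ i - C $ i)" using True by (simp add: \<eta>_def p_def fun_eq_iff)
    moreover have "\<dots> \<in> borel_measurable (F (\<sigma> j))" by measurable
    ultimately show ?thesis by (simp only:)
  next
    case False
    then have "\<eta> j = (\<lambda>_. - C $ i)" by (auto simp: \<eta>_def p_def fun_eq_iff)
    then show ?thesis by simp
  qed
  have \<eta>_bdd: "bounded (\<eta> j ` space M)" if "j < Suc (Suc k)" for j
  proof (cases "0 < j \<and> j \<le> k \<and> \<tau> (j - 1) < t")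
    case True
    then have "j - 1 < k" by auto
    then obtain b where b: "\<And>\<omega>. \<omega> \<in> space M \<Longrightarrow> norm (\<xi> (j - 1) \<omega>) \<le> b"
      using \<xi>b[of "j - 1"] unfolding bounded_iff by auto
    have "norm (\<eta> j \<omega>) \<le> b + norm (C $ i)" if "\<omega> \<in> space M" for \<omega>
    proof -
      have "norm (\<eta> j \<omega>) \<le> norm (\<xi> (j - 1) \<omega> $ i) + norm (C $ i)"
        unfolding \<eta>_def p_def using True by (simp add: norm_triangle_ineq4)
      also have "norm (\<xi> (j - 1) \<omega> $ i) \<le> norm (\<xi> (j - 1) \<omega>)" by (rule Finite_Cartesian_Product.norm_nth_le)
      finally show ?thesis using b[OF that] by simp
    qed
    then show ?thesis unfolding bounded_iff by blast
  next
    case False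
    then have "\<eta> j = (\<lambda>_. - C $ i)" by (auto simp: \<eta>_def p_def fun_eq_iff)
    then show ?thesis by (simp add: bounded_iff) blast
  qed
  define S where "S \<omega> = (\<Sum>j<Suc (Suc k). \<eta> j \<omega> \<bullet> (W (\<sigma> (Suc j)) \<omega> - W (\<sigma> j) \<omega>))" for \<omega>
  define Q where "Q \<omega> = (\<Sum>j<Suc (Suc k). (norm (\<eta> j \<omega>))\<^sup>2 * (\<sigma> (Suc j) - \<sigma> j))" for \<omega>
  note tail = ito_sum_tail_bound[where k = "Suc (Suc k)", OF \<sigma>0 \<sigma>_step \<eta>_meas \<eta>_bdd \<open>0 < \<epsilon>\<close> \<open>0 \<le> \<delta>\<close>,
      folded S_def Q_def]
  have DS: "D = S"
  proof
    fix \<omega>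
    let ?d = "\<lambda>j. W (\<sigma> (Suc j)) \<omega> - W (\<sigma> j) \<omega>"
    have "S \<omega> = (\<Sum>j<Suc (Suc k). p j \<omega> \<bullet> ?d j) - (\<Sum>j<Suc (Suc k). C $ i \<bullet> ?d j)"
      by (simp add: S_def \<eta>_def inner_diff_left sum_subtractf)
    also have "(\<Sum>j<Suc (Suc k). C $ i \<bullet> ?d j) = C $ i \<bullet> (\<Sum>j<Suc (Suc k). ?d j)"
      by (rule inner_sum_right[symmetric])
    also have "(\<Sum>j<Suc (Suc k). ?d j) = W t \<omega> - W 0 \<omega>"
      by (subst sum_lessThan_telescope) (simp add: \<sigma>_def)
    also have "(\<Sum>j<Suc (Suc k). p j \<omega> \<bullet> ?d j) = (\<Sum>j<Suc k. p j \<omega> \<bullet> ?d j)"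
      by (subst sum.lessThan_Suc) (simp add: p_def)
    also have "\<dots> = (\<Sum>j<k. p (Suc j) \<omega> \<bullet> ?d (Suc j))"
      by (subst sum.lessThan_Suc_shift) (simp add: p_def)
    also have "\<dots> = (\<Sum>j<k. \<xi> j \<omega> $ i \<bullet> (W (min (\<tau> (Suc j)) t) \<omega> - W (min (\<tau> j) t) \<omega>))"
    proof (rule sum.cong[OF refl])
      fix j assume "j \<in> {..<k}"
      moreover have "min (\<tau> (Suc j)) t = min (\<tau> j) t" if "\<not> \<tau> j < t" "j < k"
        using that \<tau>[rule_format, of j] by (simp add: min_def)
      ultimately show "p (Suc j) \<omega> \<bullet> ?d (Suc j) = \<xi> j \<omega> $ i \<bullet> (W (min (\<tau> (Suc j)) t) \<omega> - W (min (\<tau> j) t) \<omega>)"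
        by (auto simp: p_def \<sigma>_def)
    qed
    also have "\<dots> = elementary_integral W k \<tau> \<xi> t \<omega> $ i"
      by (simp add: elementary_integral_def matrix_vector_mul_component)
    finally show "D \<omega> = S \<omega>" by (simp add: D_def)
  qed
  have "{\<omega> \<in> space M. Q \<omega> > \<delta>} \<subseteq> B"
  proof (rule subsetI, rule ccontr)
    fix \<omega> assume \<omega>: "\<omega> \<in> {\<omega> \<in> space M. Q \<omega> > \<delta>}" "\<omega> \<notin> B"
    have "ennreal (Q \<omega>) \<le> (\<integral>\<^sup>+ s\<in>{\<sigma> 0..\<sigma> (Suc (Suc k))}.
        ennreal ((norm (elementary_process k \<tau> \<xi> s \<omega> - C))\<^sup>2) \<partial>lborel)"
      unfolding Q_def
    proof (rule step_sum_le_nn_integral)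
      show "\<sigma> j \<le> \<sigma> (Suc j)" if "j < Suc (Suc k)" for j by (rule \<sigma>_step[OF that])
    next
      fix j s assume j: "j < Suc (Suc k)" "\<sigma> j < s" "s \<le> \<sigma> (Suc j)"
      have "p j \<omega> = elementary_process k \<tau> \<xi> s \<omega> $ i"
      proof (cases j)
        case 0
        then have "s \<le> \<tau> 0" using j by (simp add: \<sigma>_def)
        then show ?thesis using elementary_process_outside[OF \<tau>, of s \<xi> \<omega>] 0 by (simp add: p_def)
      next
        case (Suc m)
        show ?thesis
        proof (cases "m < k")
          case True
          then have m: "\<tau> m < s" "s \<le> \<tau> (Suc m)" "\<tau> m < t" using j Suc by (auto simp: \<sigma>_def min_def split: if_splits)
          then show ?thesis using elementary_process_on_step[OF \<tau> True m(1,2), of \<xi> \<omega>] Suc True by (simp add: p_def)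
        next
          case False
          then have "m = k" using j Suc by simp
          then have "\<tau> k < s" using j Suc by (auto simp: \<sigma>_def min_def split: if_splits)
          then show ?thesis using elementary_process_outside[OF \<tau>, of s \<xi> \<omega>] Suc \<open>m = k\<close> by (simp add: p_def)
        qed
      qed
      then have "\<eta> j \<omega> = (elementary_process k \<tau> \<xi> s \<omega> - C) $ i" by (simp add: \<eta>_def)
      then have "norm (\<eta> j \<omega>) \<le> norm (elementary_process k \<tau> \<xi> s \<omega> - C)"
        by (simp only: Finite_Cartesian_Product.norm_nth_le)
      then show "(norm (\<eta> j \<omega>))\<^sup>2 \<le> (norm (elementary_process k \<tau> \<xi> s \<omega> - C))\<^sup>2"
        by (rule power_mono) simp
    qed simp_all
    also have "{\<sigma> 0..\<sigma> (Suc (Suc k))} = {0..t}" by (simp add: \<sigma>_def)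
    also have "(\<integral>\<^sup>+ s\<in>{0..t}. ennreal ((norm (elementary_process k \<tau> \<xi> s \<omega> - C))\<^sup>2) \<partial>lborel) \<le> ennreal \<delta>"
      using close \<omega> by blast
    finally have "Q \<omega> \<le> \<delta>" using \<open>0 \<le> \<delta>\<close> by (simp add: ennreal_le_iff)
    then show False using \<omega> by simp
  qed
  then have "prob {\<omega> \<in> space M. Q \<omega> > \<delta>} \<le> prob B"
    using B by (rule finite_measure_mono)
  then show "prob {\<omega> \<in> space M. \<bar>D \<omega>\<bar> \<ge> \<epsilon>} \<le> real CARD('r) * \<delta> / \<epsilon>\<^sup>2 + prob B"
    unfolding DS using tail(3) by simp
  show "D \<in> borel_measurable M" unfolding DS using tail(1) by simp
qed

lemma elementary_integral_measurable:
  assumes data: "elementary_data M F k \<tau> \<xi>" and "0 \<le> t"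
  shows "elementary_integral W k \<tau> \<xi> t \<in> borel_measurable M"
proof -
  have nn: "0 \<le> \<tau> j" if "j \<le> k" for j
    using elementary_grid_nonneg[OF data that] .
  have "\<xi> j \<in> borel_measurable M" if "j < k" for j
    using F_measurable_imp nn[of j] that data unfolding elementary_data_def by auto
  then show ?thesis
    unfolding elementary_integral_def
    by (intro borel_measurable_sum borel_measurable_matrix_vector_mult borel_measurable_diff W_measurable)
       (use nn \<open>0 \<le> t\<close> in auto)
qed

text \<open>
  The measure of a nonmeasurable set is \<open>0\<close> by convention, so convergence in probability of the
  approximating integrands has content only together with this measurability.
\<close>

lemma integrand_distance_measurable:
  assumes data: "elementary_data M F k \<tau> \<xi>"
    and H: "(\<lambda>(t, \<omega>). H t \<omega>) \<in> borel_measurable (restrict_space borel {0..} \<Otimes>\<^sub>M M)"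
  shows "(\<lambda>(\<omega>, s). ennreal ((norm (elementary_process k \<tau> \<xi> s \<omega> - H s \<omega>))\<^sup>2) * indicator {0..t} s)
    \<in> borel_measurable (M \<Otimes>\<^sub>M lborel)"
proof -
  have nn: "0 \<le> \<tau> j" if "j \<le> k" for j
    using elementary_grid_nonneg[OF data that] .
  have [measurable]: "\<xi> j \<in> borel_measurable M" if "j \<in> {..<k}" for j
    using F_measurable_imp nn[of j] that data unfolding elementary_data_def by auto
  (* H is measurable only on nonnegative times; precomposing with max 0 extends it without changing
     the values on [0, t]. *)
  have "(\<lambda>(\<omega>, s :: real). (max 0 s, \<omega>)) \<in> M \<Otimes>\<^sub>M lborel \<rightarrow>\<^sub>M restrict_space borel {0..} \<Otimes>\<^sub>M M"
    unfolding case_prod_beta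
  proof (intro measurable_Pair measurable_restrict_space2)
    show "(\<lambda>p. max 0 (snd p) :: real) \<in> borel_measurable (M \<Otimes>\<^sub>M lborel)" by measurable
  qed (simp_all add: Pi_iff)
  from measurable_compose[OF this H]
  have [measurable]: "(\<lambda>p. H (max 0 (snd p)) (fst p)) \<in> borel_measurable (M \<Otimes>\<^sub>M lborel)"
    by (simp add: case_prod_beta)
  have "(\<lambda>p. ennreal ((norm (elementary_process k \<tau> \<xi> (snd p) (fst p) - H (max 0 (snd p)) (fst p)))\<^sup>2)
      * indicator {0..t} (snd p)) \<in> borel_measurable (M \<Otimes>\<^sub>M lborel)"
    unfolding elementary_process_def by measurable
  also have "(\<lambda>p. ennreal ((norm (elementary_process k \<tau> \<xi> (snd p) (fst p) - H (max 0 (snd p)) (fst p)))\<^sup>2)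
      * indicator {0..t} (snd p)) = (\<lambda>(\<omega>, s). ennreal ((norm (elementary_process k \<tau> \<xi> s \<omega> - H s \<omega>))\<^sup>2) * indicator {0..t} s)"
    by (auto simp: fun_eq_iff indicator_def)
  finally show ?thesis .
qed

text \<open>
  Elementary approximations \<open>E\<close> of \<open>H\<close> satisfy \<open>\<bar>E - C\<bar>\<^sup>2 \<le> 2 \<bar>E - H\<bar>\<^sup>2 + 2 \<bar>H - C\<bar>\<^sup>2\<close>, so off \<open>B\<close> and an event of
  vanishing probability they are within \<open>2 q t + 2 q t\<close> of \<open>C\<close> in squared \<open>L\<^sup>2([0, t])\<close> distance.  The tail bound for
  elementary integrals then passes to the limit, one \<open>\<epsilon>\<close> being spent on the approximation of \<open>I t\<close>.
\<close>

lemma ito_integral_near_constant: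
  fixes H :: "real \<Rightarrow> 'w \<Rightarrow> real ^ 'r ^ 'n" and C :: "real ^ 'r ^ 'n" and i :: 'n
  assumes ito: "has_ito_integral M F W H I" and "0 < t" "0 < \<epsilon>" "0 < q"
    and B: "B \<in> events"
    and close: "\<And>\<omega> s. \<omega> \<in> space M \<Longrightarrow> \<omega> \<notin> B \<Longrightarrow> 0 \<le> s \<Longrightarrow> (norm (H s \<omega> - C))\<^sup>2 \<le> q"
  shows "prob {\<omega> \<in> space M. \<bar>I t \<omega> $ i - C $ i \<bullet> (W t \<omega> - W 0 \<omega>)\<bar> \<ge> 2 * \<epsilon>}
    \<le> real CARD('r) * (4 * q * t) / \<epsilon>\<^sup>2 + prob B"
proof -
  have Hm: "(\<lambda>(t, \<omega>). H t \<omega>) \<in> borel_measurable (restrict_space borel {0..} \<Otimes>\<^sub>M M)"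
    and It[measurable]: "I t \<in> borel_measurable M"
    using ito \<open>0 < t\<close> unfolding has_ito_integral_def by auto
  from ito obtain k \<tau> \<xi> where data: "\<forall>m. elementary_data M F (k m) (\<tau> m) (\<xi> m)"
    and conv: "\<forall>t\<ge>0. \<forall>\<epsilon>>0. (\<lambda>m. measure M {\<omega> \<in> space M.
        (\<integral>\<^sup>+ s\<in>{0..t}. ennreal ((norm (elementary_process (k m) (\<tau> m) (\<xi> m) s \<omega> - H s \<omega>))\<^sup>2) \<partial>lborel)
          > ennreal \<epsilon>}) \<longlonglongrightarrow> 0"
    and convI: "\<forall>t\<ge>0. \<forall>\<epsilon>>0. (\<lambda>m. measure M {\<omega> \<in> space M.
        norm (elementary_integral W (k m) (\<tau> m) (\<xi> m) t \<omega> - I t \<omega>) > \<epsilon>}) \<longlonglongrightarrow> 0"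
    unfolding has_ito_integral_def by (elim conjE exE) (rule that)
  note data = data[rule_format]
  have t0: "0 \<le> t" using \<open>0 < t\<close> by simp
  note conv = conv[rule_format, OF t0] and convI = convI[rule_format, OF t0]
  let ?E = "\<lambda>m. elementary_process (k m) (\<tau> m) (\<xi> m)"
  let ?EI = "\<lambda>m. elementary_integral W (k m) (\<tau> m) (\<xi> m) t"
  define N where "N m \<omega> = (\<integral>\<^sup>+ s\<in>{0..t}. ennreal ((norm (?E m s \<omega> - H s \<omega>))\<^sup>2) \<partial>lborel)" for m \<omega>
  define B1 where "B1 m = {\<omega> \<in> space M. N m \<omega> > ennreal (q * t)}" for m
  define B2 where "B2 m = {\<omega> \<in> space M. norm (?EI m \<omega> - I t \<omega>) > \<epsilon>}" for m
  note jm = integrand_distance_measurable[OF data Hm, where t = t]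
  have [measurable]: "N m \<in> borel_measurable M" for m
    unfolding N_def by (rule lborel.borel_measurable_nn_integral[OF jm])
  have [measurable]: "?EI m \<in> borel_measurable M" for m
    using elementary_integral_measurable[OF data] \<open>0 < t\<close> by simp
  have [measurable]: "B1 m \<in> events" "B2 m \<in> events" for m
    unfolding B1_def B2_def by measurable
  have [measurable]: "W t \<in> borel_measurable M" "W 0 \<in> borel_measurable M"
    using W_measurable \<open>0 < t\<close> by auto
  have near: "(\<integral>\<^sup>+ s\<in>{0..t}. ennreal ((norm (?E m s \<omega> - C))\<^sup>2) \<partial>lborel) \<le> ennreal (4 * q * t)"
    if \<omega>: "\<omega> \<in> space M" "\<omega> \<notin> B1 m \<union> B" for m \<omega>
  proof -
    have sect: "(\<lambda>s. ennreal ((norm (?E m s \<omega> - H s \<omega>))\<^sup>2) * indicator {0..t} s) \<in> borel_measurable lborel"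
      using measurable_compose[OF measurable_Pair1'[OF \<omega>(1)] jm] by simp
    have "(\<integral>\<^sup>+ s\<in>{0..t}. ennreal ((norm (?E m s \<omega> - C))\<^sup>2) \<partial>lborel) \<le>
        (\<integral>\<^sup>+ s. 2 * (ennreal ((norm (?E m s \<omega> - H s \<omega>))\<^sup>2) * indicator {0..t} s)
            + ennreal (2 * q) * indicator {0..t} s \<partial>lborel)"
    proof (rule nn_integral_mono)
      fix s
      show "ennreal ((norm (?E m s \<omega> - C))\<^sup>2) * indicator {0..t} s \<le>
          2 * (ennreal ((norm (?E m s \<omega> - H s \<omega>))\<^sup>2) * indicator {0..t} s) + ennreal (2 * q) * indicator {0..t} s"
      proof (cases "s \<in> {0..t}")
        case True
        let ?a = "norm (?E m s \<omega> - H s \<omega>)" and ?b = "norm (H s \<omega> - C)"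
        have "norm (?E m s \<omega> - C) \<le> ?a + ?b"
          using norm_triangle_ineq[of "?E m s \<omega> - H s \<omega>" "H s \<omega> - C"] by simp
        then have "(norm (?E m s \<omega> - C))\<^sup>2 \<le> (?a + ?b)\<^sup>2" by (rule power_mono) simp
        also have "\<dots> \<le> 2 * ?a\<^sup>2 + 2 * ?b\<^sup>2"
          using zero_le_power2[of "?a - ?b"] unfolding power2_diff power2_sum by linarith
        also have "\<dots> \<le> 2 * ?a\<^sup>2 + 2 * q" using close[of \<omega> s] \<omega> True by simp
        finally have "ennreal ((norm (?E m s \<omega> - C))\<^sup>2) \<le> ennreal (2 * ?a\<^sup>2 + 2 * q)" by (rule ennreal_leI)
        also have "\<dots> = ennreal (2 * ?a\<^sup>2) + ennreal (2 * q)"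
          using \<open>0 < q\<close> by (intro ennreal_plus) auto
        also have "ennreal (2 * ?a\<^sup>2) = 2 * ennreal (?a\<^sup>2)" by (simp add: ennreal_mult)
        finally show ?thesis using True by simp
      qed simp
    qed
    also have "\<dots> = 2 * N m \<omega> + ennreal (2 * q) * emeasure lborel {0..t}"
      unfolding N_def using sect
      by (subst nn_integral_add) (auto simp: nn_integral_cmult nn_integral_cmult_indicator)
    also have "\<dots> \<le> 2 * ennreal (q * t) + ennreal (2 * q) * emeasure lborel {0..t}"
      using \<omega> unfolding B1_def by (intro add_right_mono mult_left_mono) auto
    also have "\<dots> = ennreal (4 * q * t)"
      using \<open>0 < q\<close> \<open>0 < t\<close> by (simp add: ennreal_mult[symmetric] ennreal_plus[symmetric] numeral_mult_ennreal del: ennreal_plus)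
    finally show ?thesis .
  qed
  have bound: "prob {\<omega> \<in> space M. \<bar>I t \<omega> $ i - C $ i \<bullet> (W t \<omega> - W 0 \<omega>)\<bar> \<ge> 2 * \<epsilon>}
      \<le> real CARD('r) * (4 * q * t) / \<epsilon>\<^sup>2 + prob B + (prob (B1 m) + prob (B2 m))" for m
  proof -
    define D where "D \<omega> = ?EI m \<omega> $ i - C $ i \<bullet> (W t \<omega> - W 0 \<omega>)" for \<omega>
    have BB: "B1 m \<union> B \<in> events" using B by measurable
    have "0 \<le> 4 * q * t" using \<open>0 < q\<close> \<open>0 < t\<close> by simp
    note T = elementary_integral_tail_bound[OF data \<open>0 < t\<close> \<open>0 < \<epsilon>\<close> this BB near, of m i, folded D_def]
    have [measurable]: "D \<in> borel_measurable M" using T(1) by simp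
    have "{\<omega> \<in> space M. \<bar>I t \<omega> $ i - C $ i \<bullet> (W t \<omega> - W 0 \<omega>)\<bar> \<ge> 2 * \<epsilon>}
        \<subseteq> {\<omega> \<in> space M. \<bar>D \<omega>\<bar> \<ge> \<epsilon>} \<union> B2 m"
    proof
      fix \<omega> assume \<omega>: "\<omega> \<in> {\<omega> \<in> space M. \<bar>I t \<omega> $ i - C $ i \<bullet> (W t \<omega> - W 0 \<omega>)\<bar> \<ge> 2 * \<epsilon>}"
      have "\<bar>?EI m \<omega> $ i - I t \<omega> $ i\<bar> \<le> norm (?EI m \<omega> - I t \<omega>)"
        using component_le_norm_cart[of "?EI m \<omega> - I t \<omega>" i] by simp
      then show "\<omega> \<in> {\<omega> \<in> space M. \<bar>D \<omega>\<bar> \<ge> \<epsilon>} \<union> B2 m"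
        using \<omega> unfolding B2_def D_def by auto
    qed
    then have "prob {\<omega> \<in> space M. \<bar>I t \<omega> $ i - C $ i \<bullet> (W t \<omega> - W 0 \<omega>)\<bar> \<ge> 2 * \<epsilon>}
        \<le> prob ({\<omega> \<in> space M. \<bar>D \<omega>\<bar> \<ge> \<epsilon>} \<union> B2 m)"
      by (rule finite_measure_mono) measurable
    also have "\<dots> \<le> prob {\<omega> \<in> space M. \<bar>D \<omega>\<bar> \<ge> \<epsilon>} + prob (B2 m)"
      by (rule measure_Un_le) measurable
    also have "prob {\<omega> \<in> space M. \<bar>D \<omega>\<bar> \<ge> \<epsilon>} \<le> real CARD('r) * (4 * q * t) / \<epsilon>\<^sup>2 + prob (B1 m \<union> B)"
      by (rule T(2))
    also have "prob (B1 m \<union> B) \<le> prob (B1 m) + prob B"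
      using B by (intro measure_Un_le) auto
    finally show ?thesis by simp
  qed
  have "(\<lambda>m. real CARD('r) * (4 * q * t) / \<epsilon>\<^sup>2 + prob B + (prob (B1 m) + prob (B2 m)))
      \<longlonglongrightarrow> real CARD('r) * (4 * q * t) / \<epsilon>\<^sup>2 + prob B + (0 + 0)"
    unfolding B1_def B2_def N_def
    using \<open>0 < q\<close> \<open>0 < t\<close> \<open>0 < \<epsilon>\<close> by (intro tendsto_intros conv convI) auto
  then show ?thesis
    using bound by (intro LIMSEQ_le_const[where X = "\<lambda>m. real CARD('r) * (4 * q * t) / \<epsilon>\<^sup>2 + prob B + (prob (B1 m) + prob (B2 m))"]) auto
qed

section \<open>Confined solutions and instability\<close>

text \<open>
  Multiplying the relation by the component \<open>a\<close> of the increment and taking expectations leaves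
  \<open>c $ a * (t - s) = 0\<close>.
\<close>

lemma increment_combination_not_constant:
  fixes c :: "real ^ 'r"
  assumes "0 \<le> s" "s < t" and "AE \<omega> in M. b + c \<bullet> (W t \<omega> - W s \<omega>) = 0"
  shows "c = 0"
proof (rule ccontr)
  assume "c \<noteq> 0"
  then obtain a where a: "c $ a \<noteq> 0" by (auto simp: vec_eq_iff)
  let ?v = "\<lambda>j \<omega>. (W t \<omega> - W s \<omega>) $ j"
  have int: "integrable M (\<lambda>\<omega>. ?v j \<omega> * ?v a \<omega>)" for j
    using increment_moments(3)[OF assms(1,2), of a] increment_uncorrelated(1)[OF assms(1,2), of j a]
    by (cases "j = a") (auto simp: power2_eq_square)
  have cov: "expectation (\<lambda>\<omega>. ?v j \<omega> * ?v a \<omega>) = (if j = a then t - s else 0)" for j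
    using increment_moments(4)[OF assms(1,2), of a] increment_uncorrelated(2)[OF assms(1,2), of j a]
    by (cases "j = a") (auto simp: power2_eq_square)
  note m = increment_moments(1,2)[OF assms(1,2), of a]
  have "expectation (\<lambda>\<omega>. b * ?v a \<omega> + (\<Sum>j\<in>UNIV. c $ j * (?v j \<omega> * ?v a \<omega>)))
      = b * expectation (?v a) + (\<Sum>j\<in>UNIV. c $ j * expectation (\<lambda>\<omega>. ?v j \<omega> * ?v a \<omega>))"
    using int m(1)
    by (subst Bochner_Integration.integral_add) (auto intro!: Bochner_Integration.integrable_sum integrable_mult_right simp: Bochner_Integration.integral_sum)
  also have "\<dots> = c $ a * (t - s)" by (simp only: cov m(2)) (simp add: if_distrib cong: if_cong)
  finally have "expectation (\<lambda>\<omega>. b * ?v a \<omega> + (\<Sum>j\<in>UNIV. c $ j * (?v j \<omega> * ?v a \<omega>))) = c $ a * (t - s)" .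
  moreover have "expectation (\<lambda>\<omega>. b * ?v a \<omega> + (\<Sum>j\<in>UNIV. c $ j * (?v j \<omega> * ?v a \<omega>))) = expectation (\<lambda>_. 0)"
  proof (rule integral_cong_AE)
    show "AE \<omega> in M. b * ?v a \<omega> + (\<Sum>j\<in>UNIV. c $ j * (?v j \<omega> * ?v a \<omega>)) = 0"
      using assms(3)
    proof eventually_elim
      case (elim \<omega>)
      have "b * ?v a \<omega> + (\<Sum>j\<in>UNIV. c $ j * (?v j \<omega> * ?v a \<omega>)) = (b + c \<bullet> (W t \<omega> - W s \<omega>)) * ?v a \<omega>"
        by (simp add: inner_vec_def distrib_right sum_distrib_right mult.assoc)
      then show ?case using elim by simp
    qed
  next
    have [measurable]: "W t \<in> borel_measurable M" "W s \<in> borel_measurable M"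
      using W_measurable assms by auto
    show "(\<lambda>\<omega>. b * ?v a \<omega> + (\<Sum>j\<in>UNIV. c $ j * (?v j \<omega> * ?v a \<omega>))) \<in> borel_measurable M"
      by measurable
  qed simp
  ultimately show False using a assms(2) by simp
qed

text \<open>
  On \<open>A\<close> the solution hardly moves and the drift is nearly constant, so the integral equation at time \<open>1\<close>
  makes the Ito integral nearly \<open>- f x\<close>.  The integrand is nearly constant as well, which makes the same
  integral nearly \<open>h x *v (W 1 - W 0)\<close>.  The two values can agree only if \<open>f x + h x *v (W 1 - W 0)\<close> is
  small.  The probability of leaving \<open>A\<close> counts twice, once for the solution and drift and once for the
  integrand.
\<close>

lemma confined_solution_tail_bound:
  fixes f :: "real ^ 'n \<Rightarrow> real ^ 'n" and h :: "real ^ 'n \<Rightarrow> real ^ 'r ^ 'n" and i :: 'n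
  assumes sol: "global_sde_solution M F W f h x0 X" and f: "continuous_on UNIV f"
    and A: "A \<in> events" and conf: "\<And>\<omega> s. \<omega> \<in> A \<Longrightarrow> 0 \<le> s \<Longrightarrow> norm (X s \<omega> - x) \<le> d"
    and x0: "norm (x0 - x) \<le> d"
    and coeff: "\<And>y. norm (y - x) \<le> d \<Longrightarrow> norm (f y - f x) \<le> p"
      "\<And>y. norm (y - x) \<le> d \<Longrightarrow> (norm (h y - h x))\<^sup>2 \<le> q"
    and "0 < q" "0 < \<epsilon>"
  shows "prob {\<omega> \<in> space M. \<bar>f x $ i + h x $ i \<bullet> (W 1 \<omega> - W 0 \<omega>)\<bar> \<ge> 2 * d + p + 2 * \<epsilon>}
    \<le> real CARD('r) * (4 * q) / \<epsilon>\<^sup>2 + 2 * prob (space M - A)"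
proof -
  obtain I where ito: "has_ito_integral M F W (\<lambda>t \<omega>. h (X t \<omega>)) I"
    and eq: "AE \<omega> in M. \<forall>t\<ge>0. X t \<omega> = x0 + (LBINT s:{0..t}. f (X s \<omega>)) + I t \<omega>"
    and cap: "continuous_adapted_process M F X"
    using sol unfolding global_sde_solution_def by auto
  have [measurable]: "I 1 \<in> borel_measurable M"
    using ito unfolding has_ito_integral_def by simp
  have [measurable]: "W 1 \<in> borel_measurable M" "W 0 \<in> borel_measurable M"
    using W_measurable by auto
  have [measurable]: "space M - A \<in> events" using A by auto
  let ?Z = "\<lambda>\<omega>. I 1 \<omega> $ i - h x $ i \<bullet> (W 1 \<omega> - W 0 \<omega>)"
  let ?Y = "\<lambda>\<omega>. f x $ i + h x $ i \<bullet> (W 1 \<omega> - W 0 \<omega>)"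
  have "AE \<omega> in M. \<omega> \<in> {\<omega> \<in> space M. \<bar>?Y \<omega>\<bar> \<ge> 2 * d + p + 2 * \<epsilon>} \<longrightarrow>
      \<omega> \<in> {\<omega> \<in> space M. \<bar>?Z \<omega>\<bar> \<ge> 2 * \<epsilon>} \<union> (space M - A)"
    using eq
  proof eventually_elim
    case (elim \<omega>)
    show ?case
    proof (intro impI, cases "\<omega> \<in> A")
      case True
      assume Y: "\<omega> \<in> {\<omega> \<in> space M. \<bar>?Y \<omega>\<bar> \<ge> 2 * d + p + 2 * \<epsilon>}"
      let ?J = "LBINT s:{0..1}. f (X s \<omega>)"
      have "continuous_on {0..} (\<lambda>t. X t \<omega>)"
        using cap Y unfolding continuous_adapted_process_def by simp
      then have "continuous_on {0..1} (\<lambda>t. X t \<omega>)" by (rule continuous_on_subset) auto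
      then have "continuous_on {0..1} (\<lambda>s. f (X s \<omega>))"
        by (intro continuous_on_compose2[OF f]) auto
      then have "norm (?J - 1 *\<^sub>R f x) \<le> p * 1"
        by (rule time_integral_near_constant[rotated]) (use conf[OF True] coeff(1) in auto)
      then have J: "\<bar>?J $ i - f x $ i\<bar> \<le> p"
        using component_le_norm_cart[of "?J - f x" i] by simp
      have "X 1 \<omega> = x0 + ?J + I 1 \<omega>" using elim by simp
      then have "I 1 \<omega> $ i + f x $ i = (X 1 \<omega> - x) $ i - (x0 - x) $ i - (?J $ i - f x $ i)"
        by simp
      moreover have "\<bar>(X 1 \<omega> - x) $ i\<bar> \<le> d"
        using conf[OF True, of 1] component_le_norm_cart[of "X 1 \<omega> - x" i] by linarith
      moreover have "\<bar>(x0 - x) $ i\<bar> \<le> d"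
        using x0 component_le_norm_cart[of "x0 - x" i] by linarith
      ultimately have "\<bar>I 1 \<omega> $ i + f x $ i\<bar> \<le> 2 * d + p" using J by linarith
      moreover have "?Y \<omega> = (I 1 \<omega> $ i + f x $ i) - ?Z \<omega>" by simp
      ultimately have "2 * \<epsilon> \<le> \<bar>?Z \<omega>\<bar>" using Y by auto
      then show "\<omega> \<in> {\<omega> \<in> space M. \<bar>?Z \<omega>\<bar> \<ge> 2 * \<epsilon>} \<union> (space M - A)" using Y by simp
    qed simp
  qed
  then have "prob {\<omega> \<in> space M. \<bar>?Y \<omega>\<bar> \<ge> 2 * d + p + 2 * \<epsilon>} \<le>
      prob ({\<omega> \<in> space M. \<bar>?Z \<omega>\<bar> \<ge> 2 * \<epsilon>} \<union> (space M - A))"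
    by (rule finite_measure_mono_AE) measurable
  also have "\<dots> \<le> prob {\<omega> \<in> space M. \<bar>?Z \<omega>\<bar> \<ge> 2 * \<epsilon>} + prob (space M - A)"
    by (rule measure_Un_le) measurable
  also have "prob {\<omega> \<in> space M. \<bar>?Z \<omega>\<bar> \<ge> 2 * \<epsilon>} \<le> real CARD('r) * (4 * q * 1) / \<epsilon>\<^sup>2 + prob (space M - A)"
    by (rule ito_integral_near_constant[OF ito zero_less_one \<open>0 < \<epsilon>\<close> \<open>0 < q\<close>])
       (use A conf coeff(2) in auto)
  finally show ?thesis by simp
qed

end

theorem theorem2:
  fixes M :: "'w measure"
    and F :: "real \<Rightarrow> 'w measure"
    and W :: "real \<Rightarrow> 'w \<Rightarrow> real ^ 'r"
    and f :: "real ^ 'n \<Rightarrow> real ^ 'n"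
    and h :: "real ^ 'n \<Rightarrow> real ^ 'r ^ 'n"
    and x :: "real ^ 'n"
  assumes "wiener_process M F W"
    and "local_lipschitz (UNIV :: real set) UNIV (\<lambda>_. f)"
    and "local_lipschitz (UNIV :: real set) UNIV (\<lambda>_. h)"
    and "has_global_solution M F W f h"
    and "h x \<noteq> 0"
  shows "\<not> stable_in_probability_at M F W f h x"
proof
  assume "stable_in_probability_at M F W f h x"
  then obtain X where sol: "\<And>x0. global_sde_solution M F W f h x0 (X x0)"
    and stable: "\<And>\<epsilon>. 0 < \<epsilon> \<Longrightarrow> ((\<lambda>x0. measure M {\<omega> \<in> space M.
        (SUP t\<in>{0..}. ereal (norm (X x0 t \<omega> - x))) < ereal \<epsilon>}) \<longlongrightarrow> 1) (at x)"
    unfolding stable_in_probability_at_def by auto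
  interpret wiener_process M F W by fact
  have f: "continuous_on UNIV f" and h: "continuous_on UNIV h"
    using local_lipschitz_continuous_on[OF assms(2), of 0] local_lipschitz_continuous_on[OF assms(3), of 0] by auto
  obtain i where i: "h x $ i \<noteq> 0" using assms(5) by (auto simp: vec_eq_iff)
  define Y where "Y \<omega> = f x $ i + h x $ i \<bullet> (W 1 \<omega> - W 0 \<omega>)" for \<omega>
  have [measurable]: "W 1 \<in> borel_measurable M" "W 0 \<in> borel_measurable M"
    using W_measurable by auto
  have [measurable]: "Y \<in> borel_measurable M" unfolding Y_def by measurable
  have small: "prob {\<omega> \<in> space M. \<bar>Y \<omega>\<bar> \<ge> 5 * \<epsilon>} \<le> \<rho>" if "0 < \<epsilon>" "0 < \<rho>" for \<epsilon> \<rho> :: real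
  proof -
    (* q makes the stochastic error in the tail bound equal to \<rho> / 2; the other half of \<rho> is left for
       twice the probability of not staying near x. *)
    define q where "q = \<rho> * \<epsilon>\<^sup>2 / (8 * real CARD('r))"
    have q: "0 < q" "real CARD('r) * (4 * q) / \<epsilon>\<^sup>2 = \<rho> / 2"
      using that by (auto simp: q_def field_simps)
    obtain d1 where d1: "0 < d1" "\<And>y. dist y x < d1 \<Longrightarrow> dist (f y) (f x) < \<epsilon>"
      using f \<open>0 < \<epsilon>\<close> unfolding continuous_on_iff by (metis UNIV_I)
    obtain d2 where d2: "0 < d2" "\<And>y. dist y x < d2 \<Longrightarrow> dist (h y) (h x) < sqrt q"
      using h q(1) unfolding continuous_on_iff by (metis UNIV_I real_sqrt_gt_zero)
    define d where "d = min \<epsilon> (min (d1 / 2) (d2 / 2))"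
    have d: "0 < d" "d \<le> \<epsilon>" "d < d1" "d < d2" using d1(1) d2(1) that by (auto simp: d_def)
    define A where "A x0 = {\<omega> \<in> space M. (SUP t\<in>{0..}. ereal (norm (X x0 t \<omega> - x))) < ereal d}" for x0
    have "\<forall>\<^sub>F x0 in at x. prob (A x0) > max 0 (1 - \<rho> / 4)"
      using order_tendstoD(1)[OF stable[OF d(1)], of "max 0 (1 - \<rho> / 4)"] that unfolding A_def by simp
    moreover have "\<forall>\<^sub>F x0 in at x. dist x0 x < d"
      using d(1) by (auto simp: eventually_at)
    ultimately have "\<forall>\<^sub>F x0 in at x. prob (A x0) > max 0 (1 - \<rho> / 4) \<and> dist x0 x < d"
      by eventually_elim simp
    then obtain x0 where x0: "prob (A x0) > 0" "prob (A x0) > 1 - \<rho> / 4" "dist x0 x < d"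
      using eventually_happens[of _ "at x"] by auto
    (* Nonmeasurable sets have measure 0, so positive probability already gives measurability. *)
    have A: "A x0 \<in> events" using x0(1) measure_notin_sets by force
    have conf: "norm (X x0 s \<omega> - x) \<le> d" if "\<omega> \<in> A x0" "0 \<le> s" for \<omega> s
    proof -
      have "ereal (norm (X x0 s \<omega> - x)) \<le> (SUP t\<in>{0..}. ereal (norm (X x0 t \<omega> - x)))"
        using that(2) by (intro SUP_upper) simp
      also have "\<dots> < ereal d" using that(1) by (simp add: A_def)
      finally show ?thesis by simp
    qed
    have hq: "(norm (h y - h x))\<^sup>2 \<le> q" if "norm (y - x) \<le> d" for y
    proof -
      have "norm (h y - h x) \<le> sqrt q" using d2(2)[of y] d(4) that by (simp add: dist_norm)
      then have "(norm (h y - h x))\<^sup>2 \<le> (sqrt q)\<^sup>2" by (rule power_mono) simp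
      then show ?thesis using q(1) by simp
    qed
    have fp: "norm (f y - f x) \<le> \<epsilon>" if "norm (y - x) \<le> d" for y
      using d1(2)[of y] d(3) that by (simp add: dist_norm)
    have "prob {\<omega> \<in> space M. \<bar>Y \<omega>\<bar> \<ge> 5 * \<epsilon>} \<le> prob {\<omega> \<in> space M. \<bar>Y \<omega>\<bar> \<ge> 2 * d + \<epsilon> + 2 * \<epsilon>}"
      by (rule finite_measure_mono) (use d(2) in auto)
    also have "\<dots> \<le> real CARD('r) * (4 * q) / \<epsilon>\<^sup>2 + 2 * prob (space M - A x0)"
      unfolding Y_def
      by (rule confined_solution_tail_bound[OF sol f A conf _ fp hq q(1) \<open>0 < \<epsilon>\<close>])
         (use x0(3) in \<open>simp_all add: dist_norm\<close>)
    also have "\<dots> \<le> \<rho>" unfolding q(2) using prob_compl[OF A] x0(2) by simp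
    finally show ?thesis .
  qed
  have "AE \<omega> in M. \<not> \<bar>Y \<omega>\<bar> \<ge> 5 * inverse (real (Suc n))" for n
  proof -
    have "prob {\<omega> \<in> space M. \<bar>Y \<omega>\<bar> \<ge> 5 * inverse (real (Suc n))} \<le> 0"
      by (rule field_le_epsilon) (use small[of "inverse (real (Suc n))"] in simp)
    then have "prob {\<omega> \<in> space M. \<bar>Y \<omega>\<bar> \<ge> 5 * inverse (real (Suc n))} = 0"
      by (simp add: measure_le_0_iff)
    then show ?thesis by (subst (asm) prob_Collect_eq_0) measurable
  qed
  then have "AE \<omega> in M. \<forall>n. \<not> \<bar>Y \<omega>\<bar> \<ge> 5 * inverse (real (Suc n))"
    unfolding AE_all_countable by blast
  then have "AE \<omega> in M. f x $ i + h x $ i \<bullet> (W 1 \<omega> - W 0 \<omega>) = 0"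
  proof eventually_elim
    case (elim \<omega>)
    have "Y \<omega> = 0"
    proof (rule ccontr)
      assume "Y \<omega> \<noteq> 0"
      then obtain n where "inverse (real (Suc n)) < \<bar>Y \<omega>\<bar> / 5"
        using reals_Archimedean[of "\<bar>Y \<omega>\<bar> / 5"] by auto
      then show False using elim[rule_format, of n] by simp
    qed
    then show ?case by (simp add: Y_def)
  qed
  from increment_combination_not_constant[OF _ _ this] i show False by simp
qed

end
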